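(* Assume that the mapping $F:\mathbb{R}^n\rightrightarrows\mathbb{R}^m$ is graphically Lipschitzian of dimension $n$ at $(\bar x,\bar y)\in\mathrm{gph}\,F$, and let $\Phi$ and $f$ be a transformation mapping and a Lipschitz mapping as in the definition of this property. Then $F$ is SCD-ss$^*$ at $(\bar x,\bar y)$ if and only if $f$ is semismooth with respect to $\overline{\nabla}f$ at $\bar u$, where $(\bar u,f(\bar u))=\Phi(\bar x,\bar y)$.
   Context: Multifunctions: $\mathrm{gph}\,F=\{(x,y) : y\in F(x)\}$, $\mathrm{dom}\,F=\{x : F(x)\ne\emptyset\}$. Graphically Lipschitzian: $F:\mathbb{R}^n\rightrightarrows\mathbb{R}^m$ is graphically Lipschitzian of dimension $d$ at $(\bar x,\bar y)\in\mathrm{gph}\,F$ if there is an open neighborhood $W$ of $(\bar x,\bar y)$ and a one-to-one mapping $\Phi$ from $W$ onto an open subset of $\mathbb{R}^{n+m}$ with $\Phi$ and $\Phi^{-1}$ continuously differentiable, such that $\Phi(\mathrm{gph}\,F\cap W)$ is the graph of a Lipschitz continuous mapping $f:U\to\mathbb{R}^{n+m-d}$, where $U\subset\mathbb{R}^d$ is open. SC derivative: $\mathcal{Z}_{n,m}$ is the metric space of all $n$-dimensional subspaces of $\mathbb{R}^{n+m}=\mathbb{R}^n\times\mathbb{R}^m$ with metric $d(L_1,L_2)=\|P_1-P_2\|$, $P_i$ the orthogonal projection matrix onto $L_i$. The tangent (Bouligand) cone is $T_\Omega(z)=\{w : \exists t_k\downarrow0,\ w_k\to w,\ z+t_kw_k\in\Omega\}$.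 $\mathcal{O}_F$ is the set of $(x,y)\in\mathrm{gph}\,F$ with $T_{\mathrm{gph}\,F}(x,y)\in\mathcal{Z}_{n,m}$. Define $\mathcal{S}F(x,y)=\{L\in\mathcal{Z}_{n,m} : \exists (x_k,y_k)\in\mathcal{O}_F,\ (x_k,y_k)\to(x,y),\ d(L,T_{\mathrm{gph}\,F}(x_k,y_k))\to0\}$. For $L\in\mathcal{Z}_{n,m}$ the adjoint subspace is $L^*=\{(-v^*,u^* )\in\mathbb{R}^m\times\mathbb{R}^n : (u^*,v^* )\in L^\perp\}$, and $\mathcal{S}^*F(x,y)=\{L^* : L\in\mathcal{S}F(x,y)\}$, $(\bigcup\mathcal{S}^*F)(x,y)=\bigcup_{L^*\in\mathcal{S}^*F(x,y)}L^*$. SCD-ss$^*$: $F$ is SCD-ss$^*$ at $(\bar x,\bar y)\in\mathrm{gph}\,F$ if there is a neighborhood $N$ of $(\bar x,\bar y)$ such that $\mathcal{S}^*F(x,y)\neq\emptyset$ for all $(x,y)\in\mathrm{gph}\,F\cap N$, and for every $\epsilon>0$ there is $\delta>0$ such that $|\langle x^*,x-\bar x\rangle-\langle y^*,y-\bar y\rangle|\le\epsilon\|(x,y)-(\bar x,\bar y)\|\,\|(y^*,x^* )\|$ for all $(x,y)\in\mathrm{gph}\,F$ with $\|(x,y)-(\bar x,\bar y)\|\le\delta$ and all $(y^*,x^* )\in(\bigcup\mathcal{S}^*F)(x,y)$. B-Jacobian: $\overline{\nabla}f(u)=\{A : A=\lim_k\nabla f(u_k),\ u_k\to u,\ f\text{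 Fréchet differentiable at }u_k\}$, $u\in U$. Semismoothness: a mapping $f:U\to\mathbb{R}^m$ ($U\subset\mathbb{R}^n$ open) is semismooth with respect to a multifunction $\Psi:\mathbb{R}^n\rightrightarrows\mathbb{R}^{m\times n}$ at $\bar u\in U$ if $\mathrm{dom}\,\Psi$ is a neighborhood of $\bar u$, $\Psi$ is locally bounded at $\bar u$ (its values are uniformly bounded on a neighborhood of $\bar u$), and $\lim_{u\to\bar u,\,u\in U,\,u\neq\bar u}\sup\{\|f(u)-f(\bar u)-A(u-\bar u)\| : A\in\Psi(u)\}/\|u-\bar u\|=0$. *)

theory Defs
  imports "HOL-Analysis.Analysis"
begin

text \<open>A multifunction from \<open>'a\<close> to \<open>'b\<close> is a set-valued map \<open>'a \<Rightarrow> 'b set\<close>.\<close>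

definition gph :: "('a \<Rightarrow> 'b set) \<Rightarrow> ('a \<times> 'b) set" where
  "gph F = {(x, y). y \<in> F x}"

definition mdom :: "('a \<Rightarrow> 'b set) \<Rightarrow> 'a set" where
  "mdom F = {x. F x \<noteq> {}}"

definition continuously_differentiable_on ::
    "('a::real_normed_vector \<Rightarrow> 'b::real_normed_vector) \<Rightarrow> 'a set \<Rightarrow> bool" where
  "continuously_differentiable_on g S \<longleftrightarrow>
     (\<exists>D :: 'a \<Rightarrow> 'a \<Rightarrow>\<^sub>L 'b.
        (\<forall>z\<in>S. (g has_derivative blinfun_apply (D z)) (at z)) \<and> continuous_on S D)"

text \<open>
  The data \<open>W\<close>, \<open>\<Phi>\<close>, \<open>U\<close>, \<open>f\<close> witnessing that \<open>F\<close> is graphically Lipschitzian of dimension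
  \<open>d = CARD('d)\<close> at \<open>z\<close>. The space \<open>\<real>\<^sup>n\<^sup>+\<^sup>m\<close> is split as \<open>\<real>\<^sup>n \<times> \<real>\<^sup>m\<close> in the source of \<open>\<Phi>\<close> and as
  \<open>\<real>\<^sup>d \<times> \<real>\<^sup>e\<close> with \<open>e = n + m - d\<close> in its target. Outside \<open>W\<close> and \<open>U\<close> the values of the (total)
  functions \<open>\<Phi>\<close> and \<open>f\<close> are irrelevant.
\<close>
definition graphically_lipschitzian_via ::
    "(real^'n \<Rightarrow> (real^'m) set) \<Rightarrow> (real^'n) \<times> (real^'m)
     \<Rightarrow> ((real^'n) \<times> (real^'m)) set \<Rightarrow> ((real^'n) \<times> (real^'m) \<Rightarrow> (real^'d) \<times> (real^'e))
     \<Rightarrow> (real^'d) set \<Rightarrow> (real^'d \<Rightarrow> real^'e) \<Rightarrow> bool" where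
  "graphically_lipschitzian_via F z W \<Phi> U f \<longleftrightarrow>
     CARD('d) + CARD('e) = CARD('n) + CARD('m) \<and>
     z \<in> gph F \<and> open W \<and> z \<in> W \<and>
     inj_on \<Phi> W \<and> open (\<Phi> ` W) \<and>
     continuously_differentiable_on \<Phi> W \<and>
     continuously_differentiable_on (the_inv_into W \<Phi>) (\<Phi> ` W) \<and>
     open U \<and> (\<exists>C. C-lipschitz_on U f) \<and>
     \<Phi> ` (gph F \<inter> W) = {(u, f u) | u. u \<in> U}"

definition tangent_cone :: "'a::real_normed_vector set \<Rightarrow> 'a \<Rightarrow> 'a set" where
  "tangent_cone \<Omega> z =
     {w. \<exists>(t :: nat \<Rightarrow> real) v. (\<forall>k. t k > 0) \<and> t \<longlonglongrightarrow> 0 \<and> v \<longlonglongrightarrow> w \<and>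
           (\<forall>k. z + t k *\<^sub>R v k \<in> \<Omega>)}"

text \<open>\<open>\<Z>\<^bsub>n,m\<^esub>\<close>; the dimensions are carried by the type.\<close>
definition n_subspaces :: "((real^'n) \<times> (real^'m)) set set" where
  "n_subspaces = {L. subspace L \<and> dim L = CARD('n)}"

definition orth_projection :: "'a::euclidean_space set \<Rightarrow> 'a \<Rightarrow> 'a" where
  "orth_projection L z = (THE p. p \<in> L \<and> z - p \<in> orthogonal_comp L)"

definition subspace_dist :: "'a::euclidean_space set \<Rightarrow> 'a set \<Rightarrow> real" where
  "subspace_dist L1 L2 = onorm (\<lambda>z. orth_projection L1 z - orth_projection L2 z)"

definition smooth_points ::
    "(real^'n \<Rightarrow> (real^'m) set) \<Rightarrow> ((real^'n) \<times> (real^'m)) set" where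
  "smooth_points F = {z \<in> gph F. tangent_cone (gph F) z \<in> n_subspaces}"

definition SC_derivative ::
    "(real^'n \<Rightarrow> (real^'m) set) \<Rightarrow> (real^'n) \<times> (real^'m)
     \<Rightarrow> ((real^'n) \<times> (real^'m)) set set" where
  "SC_derivative F z =
     {L \<in> n_subspaces. \<exists>\<zeta> :: nat \<Rightarrow> (real^'n) \<times> (real^'m).
        (\<forall>k. \<zeta> k \<in> smooth_points F) \<and> \<zeta> \<longlonglongrightarrow> z \<and>
        (\<lambda>k. subspace_dist L (tangent_cone (gph F) (\<zeta> k))) \<longlonglongrightarrow> 0}"

definition adjoint_subspace ::
    "((real^'n) \<times> (real^'m)) set \<Rightarrow> ((real^'m) \<times> (real^'n)) set" where
  "adjoint_subspace L = {(- v, u) | u v. (u, v) \<in> orthogonal_comp L}"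

definition adjoint_SC_derivative ::
    "(real^'n \<Rightarrow> (real^'m) set) \<Rightarrow> (real^'n) \<times> (real^'m)
     \<Rightarrow> ((real^'m) \<times> (real^'n)) set set" where
  "adjoint_SC_derivative F z = adjoint_subspace ` SC_derivative F z"

definition SCD_ss_star ::
    "(real^'n \<Rightarrow> (real^'m) set) \<Rightarrow> (real^'n) \<times> (real^'m) \<Rightarrow> bool" where
  "SCD_ss_star F zbar \<longleftrightarrow>
     zbar \<in> gph F \<and>
     (\<exists>N. open N \<and> zbar \<in> N \<and> (\<forall>z \<in> gph F \<inter> N. adjoint_SC_derivative F z \<noteq> {})) \<and>
     (\<forall>\<epsilon>>0. \<exists>\<delta>>0. \<forall>(x, y) \<in> gph F. norm ((x, y) - zbar) \<le> \<delta> \<longrightarrow>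
        (\<forall>(ystar, xstar) \<in> \<Union> (adjoint_SC_derivative F (x, y)).
           \<bar>xstar \<bullet> (x - fst zbar) - ystar \<bullet> (y - snd zbar)\<bar>
             \<le> \<epsilon> * norm ((x, y) - zbar) * norm (ystar, xstar)))"

text \<open>
  The B-Jacobian of \<open>f : U \<rightarrow> \<real>\<^sup>m\<close>, \<open>U\<close> open, as a multifunction with empty values outside \<open>U\<close>.
  The Jacobian matrix at \<open>w k\<close> is the matrix \<open>J k\<close> representing the Frechet derivative.
\<close>
definition B_Jacobian ::
    "(real^'n) set \<Rightarrow> (real^'n \<Rightarrow> real^'m) \<Rightarrow> real^'n \<Rightarrow> (real^'n^'m) set" where
  "B_Jacobian U f u =
     {A. u \<in> U \<and> (\<exists>(w :: nat \<Rightarrow> real^'n) (J :: nat \<Rightarrow> real^'n^'m).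
           (\<forall>k. w k \<in> U \<and> (f has_derivative (\<lambda>h. J k *v h)) (at (w k))) \<and>
           w \<longlonglongrightarrow> u \<and> J \<longlonglongrightarrow> A)}"

text \<open>
  The real-valued supremum below only matters for \<open>u\<close> close to \<open>ubar\<close>, where the first two
  requirements make it a supremum over a nonempty set that is bounded above.
\<close>
definition semismooth_wrt ::
    "(real^'n) set \<Rightarrow> (real^'n \<Rightarrow> real^'m) \<Rightarrow> (real^'n \<Rightarrow> (real^'n^'m) set) \<Rightarrow> real^'n \<Rightarrow> bool" where
  "semismooth_wrt U f \<Psi> ubar \<longleftrightarrow>
     ubar \<in> U \<and>
     ubar \<in> interior (mdom \<Psi>) \<and>
     (\<exists>N. open N \<and> ubar \<in> N \<and> bounded (\<Union>u\<in>N. \<Psi> u)) \<and>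
     ((\<lambda>u. (SUP A\<in>\<Psi> u. norm (f u - f ubar - A *v (u - ubar))) / norm (u - ubar)) \<longlongrightarrow> 0)
       (at ubar within U)"

end

theory Submission
  imports Defs
begin

text \<open>
  The chart \<open>\<Phi>\<close> maps the tangent cone of \<open>gph F\<close> at \<open>z\<close> linearly and bijectively onto the tangent cone
  of the graph of \<open>f\<close> at \<open>\<Phi> z\<close>. As \<open>f\<close> is Lipschitz, the latter is a subspace of full dimension iff
  \<open>f\<close> is differentiable there, in which case it is the graph of the derivative. Lipschitz bounds give
  compactness of the Jacobians, so in the limit the elements of \<open>SC_derivative F z\<close> are exactly the
  preimages under \<open>\<nabla>\<Phi>(z)\<close> of the graphs of the elements \<open>A\<close> of the B-Jacobian. In particular one
  multifunction is nonempty-valued near the reference point iff the other one is, and Rademacher's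
  theorem is not needed.

  The SCD-ss* estimate says that \<open>z - zbar\<close> has distance at most \<open>\<epsilon> * norm (z - zbar)\<close> from every
  \<open>L\<close> in \<open>SC_derivative F z\<close>. Since \<open>\<Phi> z - \<Phi> zbar\<close> equals \<open>\<nabla>\<Phi>(z) (z - zbar)\<close> up to
  \<open>o(norm (z - zbar))\<close>, this is up to constants the distance of \<open>(u - ubar, f u - f ubar)\<close> from the
  graph of \<open>A\<close>, which is comparable to \<open>norm (f u - f ubar - A *v (u - ubar))\<close>.
\<close>

subsection \<open>Orthogonal projections and the distance of subspaces\<close>

text \<open>A subsequence staying away from \<open>l\<close> would, by compactness, have a further
  subsequence with a limit other than \<open>l\<close>. The lemma reduces convergence to the
  identification of cluster points.\<close>

lemma bounded_tendsto_if_subseq_limits_unique: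
  fixes x :: "nat \<Rightarrow> 'a::heine_borel"
  assumes "bounded (range x)"
    and uniq: "\<And>r l'. strict_mono r \<Longrightarrow> (x \<circ> r) \<longlonglongrightarrow> l' \<Longrightarrow> l' = l"
  shows "x \<longlonglongrightarrow> l"
proof (rule ccontr)
  assume "\<not> ?thesis"
  then obtain e where "e > 0" and "\<not> (\<forall>\<^sub>F n in sequentially. dist (x n) l < e)"
    by (auto simp: tendsto_iff)
  then obtain r :: "nat \<Rightarrow> nat" where r: "strict_mono r" and far: "\<And>n. \<not> dist (x (r n)) l < e"
    using not_eventually_sequentiallyD[of "\<lambda>n. dist (x n) l < e"] by blast
  have "bounded (range (x \<circ> r))"
    using assms(1) by (rule bounded_subset) auto
  then obtain s l' where s: "strict_mono s" and lim: "((x \<circ> r) \<circ> s) \<longlonglongrightarrow> l'"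
    using bounded_imp_convergent_subsequence by blast
  have "l' = l"
    using uniq[of "r \<circ> s"] r s lim by (simp add: strict_mono_o o_assoc)
  then have "\<forall>\<^sub>F n in sequentially. dist (x (r (s n))) l < e"
    using lim \<open>e > 0\<close> by (auto simp: tendsto_iff)
  then show False
    using far by (auto simp: eventually_sequentially)
qed

text \<open>Two candidates differ by a vector that lies both in \<open>L\<close> and in its
  orthogonal complement. This is how the definite description in \<open>orth_projection\<close> gets
  evaluated.\<close>

lemma orth_projection_unique:
  assumes "subspace L" "p \<in> L" "z - p \<in> orthogonal_comp L"
  shows "orth_projection L z = p"
  unfolding orth_projection_def
proof (rule the_equality)
  fix q assume q: "q \<in> L \<and> z - q \<in> orthogonal_comp L"
  have "q - p \<in> L"
    using assms q by (auto intro: subspace_diff)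
  moreover have "q - p \<in> orthogonal_comp L"
    using subspace_diff[OF subspace_orthogonal_comp assms(3), of "z - q"] q by simp
  ultimately have "orthogonal (q - p) (q - p)"
    by (auto simp: orthogonal_comp_def)
  then show "q = p"
    by (simp add: orthogonal_self)
qed (use assms in auto)

lemma
  assumes "subspace L"
  shows orth_projection_in: "orth_projection L z \<in> L"
    and orth_projection_residual: "z - orth_projection L z \<in> orthogonal_comp L"
proof -
  have span: "span L = L"
    using assms by (simp add: span_eq_iff)
  obtain p q where "p \<in> span L" "\<And>w. w \<in> span L \<Longrightarrow> orthogonal q w" "z = p + q"
    by (rule orthogonal_subspace_decomp_exists[of L z]) blast
  then have "p \<in> L" "z - p \<in> orthogonal_comp L"
    by (simp_all add: span orthogonal_comp_def orthogonal_commute)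
  then show "orth_projection L z \<in> L" "z - orth_projection L z \<in> orthogonal_comp L"
    using orth_projection_unique[OF assms] by auto
qed

lemma linear_orth_projection:
  assumes "subspace L"
  shows "linear (orth_projection L)"
proof (rule linearI)
  note P = orth_projection_in[OF assms] orth_projection_residual[OF assms]
  fix x y :: 'a and c :: real
  have "x + y - (orth_projection L x + orth_projection L y) \<in> orthogonal_comp L"
    using subspace_add[OF subspace_orthogonal_comp P(2)[of x] P(2)[of y]] by (simp add: algebra_simps)
  then show "orth_projection L (x + y) = orth_projection L x + orth_projection L y"
    by (intro orth_projection_unique subspace_add assms P(1))
  have "c *\<^sub>R x - c *\<^sub>R orth_projection L x \<in> orthogonal_comp L"
    using subspace_scale[OF subspace_orthogonal_comp P(2)[of x]] by (simp add: scaleR_diff_right)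
  then show "orth_projection L (c *\<^sub>R x) = c *\<^sub>R orth_projection L x"
    by (intro orth_projection_unique subspace_scale assms P(1))
qed

lemma norm_orth_projection_le:
  assumes "subspace L"
  shows "norm (orth_projection L z) \<le> norm z"
proof -
  have "orthogonal (orth_projection L z) (z - orth_projection L z)"
    using orth_projection_in[OF assms, of z] orth_projection_residual[OF assms, of z]
    by (auto simp: orthogonal_comp_def)
  then have "(norm z)\<^sup>2 = (norm (orth_projection L z))\<^sup>2 + (norm (z - orth_projection L z))\<^sup>2"
    using norm_add_Pythagorean[of "orth_projection L z" "z - orth_projection L z"] by simp
  then have "(norm (orth_projection L z))\<^sup>2 \<le> (norm z)\<^sup>2"
    by simp
  then show ?thesis
    by (rule power2_le_imp_le) simp
qed

text \<open>A vector of \<open>L\<close> is its own projection, so its distance to its projection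
  onto \<open>T k\<close> is at most the operator norm of the difference of projections times its
  norm. This yields vectors of \<open>T k\<close> approximating a given vector of
  \<open>L\<close>.\<close>

lemma subspace_dist_tendsto_imp_orth_projection_tendsto:
  fixes L :: "'a::euclidean_space set"
  assumes "subspace L" "\<And>k. subspace (T k)" "w \<in> L"
    and lim: "(\<lambda>k. subspace_dist L (T k)) \<longlonglongrightarrow> 0"
  shows "(\<lambda>k. orth_projection (T k) w) \<longlonglongrightarrow> w"
proof -
  have Lw: "orth_projection L w = w"
    using assms(1,3) by (intro orth_projection_unique) (simp_all add: subspace_0 subspace_orthogonal_comp)
  have bound: "norm (w - orth_projection (T k) w) \<le> subspace_dist L (T k) * norm w" for k
  proof -
    have "bounded_linear (\<lambda>z. orth_projection L z - orth_projection (T k) z)"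
      by (intro bounded_linear_sub linear_conv_bounded_linear[THEN iffD1] linear_orth_projection assms)
    from onorm[OF this, of w] show ?thesis
      by (simp add: Lw subspace_dist_def)
  qed
  have "(\<lambda>k. subspace_dist L (T k) * norm w) \<longlonglongrightarrow> 0"
    using tendsto_mult_right[OF lim, of "norm w"] by simp
  then have "(\<lambda>k. w - orth_projection (T k) w) \<longlonglongrightarrow> 0"
    by (rule Lim_null_comparison[OF always_eventually, rotated]) (simp add: bound)
  from tendsto_diff[OF tendsto_const[of w] this] show ?thesis
    by simp
qed

text \<open>The two hypotheses on limits are Painleve--Kuratowski convergence of \<open>T k\<close> to \<open>L\<close>.\<close>

lemma subspace_dist_tendsto_0I:
  fixes L :: "'a::euclidean_space set"
  assumes "subspace L" "\<And>k. subspace (T k)"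
    and outer: "\<And>r p l. strict_mono r \<Longrightarrow> (\<And>k. p k \<in> T (r k)) \<Longrightarrow> p \<longlonglongrightarrow> l \<Longrightarrow> l \<in> L"
    and inner: "\<And>l. l \<in> L \<Longrightarrow> \<exists>p. (\<forall>k. p k \<in> T k) \<and> p \<longlonglongrightarrow> l"
  shows "(\<lambda>k. subspace_dist L (T k)) \<longlonglongrightarrow> 0"
proof -
  \<comment> \<open>Projections of \<open>z\<close> stay bounded by \<open>norm z\<close>. A cluster
    point lies in \<open>L\<close> by \<open>outer\<close>; its residual is orthogonal to
    \<open>L\<close> because \<open>inner\<close> approximates each \<open>y\<close> in
    \<open>L\<close> by vectors of \<open>T k\<close>, for which orthogonality holds
    exactly.\<close>
  have pw: "(\<lambda>k. orth_projection (T k) z) \<longlonglongrightarrow> orth_projection L z" for z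
  proof (rule bounded_tendsto_if_subseq_limits_unique)
    show "bounded (range (\<lambda>k. orth_projection (T k) z))"
      using norm_orth_projection_le assms(2) by (auto intro!: boundedI)
    fix r l assume r: "strict_mono r" and "((\<lambda>k. orth_projection (T k) z) \<circ> r) \<longlonglongrightarrow> l"
    then have l: "(\<lambda>k. orth_projection (T (r k)) z) \<longlonglongrightarrow> l"
      by (simp add: o_def)
    have "l \<in> L"
      by (rule outer[OF r _ l]) (simp add: orth_projection_in assms(2))
    moreover have "z - l \<in> orthogonal_comp L"
      unfolding orthogonal_comp_def orthogonal_def
    proof safe
      fix y assume "y \<in> L"
      then obtain p where p: "\<And>k. p k \<in> T k" "p \<longlonglongrightarrow> y"
        using inner by blast
      have "p (r k) \<bullet> (z - orth_projection (T (r k)) z) = 0" for k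
        using orth_projection_residual[OF assms(2)[of "r k"], of z] p(1)
        by (simp add: orthogonal_comp_def orthogonal_def)
      moreover have "(\<lambda>k. p (r k) \<bullet> (z - orth_projection (T (r k)) z)) \<longlonglongrightarrow> y \<bullet> (z - l)"
        using LIMSEQ_subseq_LIMSEQ[OF p(2) r] l by (auto intro!: tendsto_intros simp: o_def)
      ultimately show "y \<bullet> (z - l) = 0"
        by (simp add: LIMSEQ_const_iff)
    qed
    ultimately show "l = orth_projection L z"
      using orth_projection_unique[OF assms(1)] by simp
  qed
  let ?\<Delta> = "\<lambda>k z. orth_projection L z - orth_projection (T k) z"
  have lin: "bounded_linear (?\<Delta> k)" for k
    by (intro bounded_linear_sub linear_conv_bounded_linear[THEN iffD1] linear_orth_projection assms)
  \<comment> \<open>In finite dimension the operator norm is controlled by the images of the basis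
    vectors, so pointwise convergence suffices.\<close>
  have bound: "norm (subspace_dist L (T k)) \<le> (\<Sum>b\<in>Basis. norm (?\<Delta> k b))" for k
    using onorm_componentwise[OF lin, of k] onorm_pos_le[OF lin, of k] by (simp add: subspace_dist_def)
  have "(\<lambda>k. ?\<Delta> k b) \<longlonglongrightarrow> 0" for b
    using tendsto_diff[OF tendsto_const[of "orth_projection L b"] pw[of b]] by simp
  then have "(\<lambda>k. \<Sum>b\<in>Basis. norm (?\<Delta> k b)) \<longlonglongrightarrow> 0"
    by (intro tendsto_null_sum tendsto_norm_zero)
  then show ?thesis
    by (rule Lim_null_comparison[OF always_eventually, rotated]) (intro allI bound)
qed

subsection \<open>Tangent cones of images and graphs\<close>

text \<open>This is the Hadamard form of the derivative, with moving directions: a convergent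
  \<open>v\<close> is bounded, so the Frechet remainder at step \<open>t k *\<^sub>R v k\<close> is
  small relative to \<open>t k\<close>.\<close>

lemma has_derivative_difference_quotient_tendsto:
  fixes g :: "'a::real_normed_vector \<Rightarrow> 'b::real_normed_vector"
  assumes g: "(g has_derivative D) (at z)"
    and t: "\<And>k. t k > 0" "t \<longlonglongrightarrow> 0" and v: "v \<longlonglongrightarrow> w"
  shows "(\<lambda>k. (g (z + t k *\<^sub>R v k) - g z) /\<^sub>R t k) \<longlonglongrightarrow> D w"
proof -
  interpret D: bounded_linear D
    using g by (rule has_derivative_bounded_linear)
  let ?q = "\<lambda>k. (g (z + t k *\<^sub>R v k) - g z) /\<^sub>R t k"
  obtain B where "B > 0" and B: "\<And>k. norm (v k) \<le> B"
    using convergent_imp_bounded[OF v] by (auto simp: bounded_pos)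
  have "(\<lambda>k. ?q k - D (v k)) \<longlonglongrightarrow> 0"
  proof (rule tendstoI)
    fix e :: real assume "e > 0"
    \<comment> \<open>\<open>B\<close> absorbs the size of the directions; the factor 2 makes the
      final inequality strict.\<close>
    then have "e / (2 * B) > 0"
      using \<open>B > 0\<close> by simp
    then obtain d where "d > 0"
      and d: "\<And>y. norm (y - z) < d \<Longrightarrow> norm (g y - g z - D (y - z)) \<le> e / (2 * B) * norm (y - z)"
      using g unfolding has_derivative_at_alt by blast
    have "(\<lambda>k. t k *\<^sub>R v k) \<longlonglongrightarrow> 0"
      using tendsto_scaleR[OF t(2) v] by simp
    then have "\<forall>\<^sub>F k in sequentially. norm (t k *\<^sub>R v k) < d"
      using \<open>d > 0\<close> by (auto simp: tendsto_iff)
    then show "\<forall>\<^sub>F k in sequentially. dist (?q k - D (v k)) 0 < e"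
    proof eventually_elim
      case (elim k)
      have "?q k - D (v k) = (g (z + t k *\<^sub>R v k) - g z - D (t k *\<^sub>R v k)) /\<^sub>R t k"
        using t(1)[of k] by (simp add: D.scaleR scaleR_right_diff_distrib)
      then have "norm (?q k - D (v k)) = norm (g (z + t k *\<^sub>R v k) - g z - D (t k *\<^sub>R v k)) / t k"
        using t(1)[of k] by (simp add: divide_inverse mult.commute)
      also have "\<dots> \<le> e / (2 * B) * norm (t k *\<^sub>R v k) / t k"
        using d[of "z + t k *\<^sub>R v k"] elim t(1)[of k] by (intro divide_right_mono) auto
      also have "\<dots> = e / (2 * B) * norm (v k)"
        using t(1)[of k] by simp
      also have "\<dots> \<le> e / (2 * B) * B"
        using B[of k] \<open>B > 0\<close> \<open>e > 0\<close> by (intro mult_left_mono) auto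
      also have "\<dots> < e"
        using \<open>B > 0\<close> \<open>e > 0\<close> by simp
      finally show ?case
        by simp
    qed
  qed
  from tendsto_add[OF this D.tendsto[OF v]] show ?thesis
    by simp
qed

text \<open>The difference quotients of \<open>g\<close> along a tangent sequence serve as the
  directions of a sequence in the image set with the same step sizes.\<close>

lemma tangent_cone_has_derivative:
  assumes g: "(g has_derivative D) (at z)"
    and maps: "\<forall>\<^sub>F z' in nhds z. z' \<in> \<Omega> \<longrightarrow> g z' \<in> \<Gamma>"
    and w: "w \<in> tangent_cone \<Omega> z"
  shows "D w \<in> tangent_cone \<Gamma> (g z)"
proof -
  obtain t v where t: "\<And>k. t k > 0" "t \<longlonglongrightarrow> 0" and v: "v \<longlonglongrightarrow> w"
    and mem: "\<And>k. z + t k *\<^sub>R v k \<in> \<Omega>"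
    using w by (auto simp: tangent_cone_def)
  have "(\<lambda>k. z + t k *\<^sub>R v k) \<longlonglongrightarrow> z"
    using tendsto_add[OF tendsto_const[of z] tendsto_scaleR[OF t(2) v]] by simp
  then have "\<forall>\<^sub>F k in sequentially. g (z + t k *\<^sub>R v k) \<in> \<Gamma>"
    by (rule eventually_mono[OF eventually_compose_filterlim[OF maps]]) (use mem in blast)
  \<comment> \<open>\<open>tangent_cone\<close> asks for membership at every index, whereas
    \<open>maps\<close> is only local, so the first \<open>N\<close> terms are dropped by a
    shift.\<close>
  then obtain N where N: "\<And>k. k \<ge> N \<Longrightarrow> g (z + t k *\<^sub>R v k) \<in> \<Gamma>"
    by (auto simp: eventually_sequentially)
  let ?q = "\<lambda>k. (g (z + t k *\<^sub>R v k) - g z) /\<^sub>R t k"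
  have "(\<lambda>k. t (k + N)) \<longlonglongrightarrow> 0"
    using t(2) by (rule LIMSEQ_ignore_initial_segment)
  moreover have "(\<lambda>k. ?q (k + N)) \<longlonglongrightarrow> D w"
    using has_derivative_difference_quotient_tendsto[OF g t v] by (rule LIMSEQ_ignore_initial_segment)
  moreover have "g z + t (k + N) *\<^sub>R ?q (k + N) \<in> \<Gamma>" for k
    using N[of "k + N"] t(1)[of "k + N"] by simp
  ultimately show ?thesis
    unfolding tangent_cone_def mem_Collect_eq using t(1)
    by (intro exI[of _ "\<lambda>k. t (k + N)"] exI[of _ "\<lambda>k. ?q (k + N)"] conjI allI)
qed

definition fun_graph :: "'a set \<Rightarrow> ('a \<Rightarrow> 'b) \<Rightarrow> ('a \<times> 'b) set" where
  "fun_graph U f = {(u, f u) | u. u \<in> U}"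

text \<open>In one direction, the second component of a secant direction is a difference quotient of
  \<open>f\<close> and converges to the derivative. In the other, the graph map sends the tangent
  cone of the whole space, which is everything, into the cone of the graph.\<close>

lemma tangent_cone_fun_graph:
  fixes f :: "'a::real_normed_vector \<Rightarrow> 'b::real_normed_vector"
  assumes "open U" "u \<in> U" and f: "(f has_derivative A) (at u)"
  shows "tangent_cone (fun_graph U f) (u, f u) = fun_graph UNIV A"
proof (intro equalityI subsetI)
  fix p assume "p \<in> tangent_cone (fun_graph U f) (u, f u)"
  then obtain t v where t: "\<And>k. t k > 0" "t \<longlonglongrightarrow> 0" and v: "v \<longlonglongrightarrow> p"
    and mem: "\<And>k. (u, f u) + t k *\<^sub>R v k \<in> fun_graph U f"
    by (auto simp: tangent_cone_def)
  have "snd (v k) = (f (u + t k *\<^sub>R fst (v k)) - f u) /\<^sub>R t k" for k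
  proof -
    have "f (u + t k *\<^sub>R fst (v k)) = f u + t k *\<^sub>R snd (v k)"
      using mem[of k] by (auto simp: fun_graph_def plus_prod_def)
    then show ?thesis
      using t(1)[of k] by simp
  qed
  then have "(\<lambda>k. snd (v k)) \<longlonglongrightarrow> A (fst p)"
    using has_derivative_difference_quotient_tendsto[OF f t tendsto_fst[OF v]] by simp
  then have "snd p = A (fst p)"
    using LIMSEQ_unique tendsto_snd[OF v] by blast
  then show "p \<in> fun_graph UNIV A"
    by (cases p) (auto simp: fun_graph_def)
next
  fix p assume "p \<in> fun_graph UNIV A"
  then obtain h where p: "p = (h, A h)"
    by (auto simp: fun_graph_def)
  have "h \<in> tangent_cone UNIV u"
    unfolding tangent_cone_def
    by (auto intro!: exI[of _ "\<lambda>k. inverse (real (Suc k))"] exI[of _ "\<lambda>_. h"]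
        LIMSEQ_inverse_real_of_nat simp del: of_nat_Suc)
  moreover have "((\<lambda>u. (u, f u)) has_derivative (\<lambda>h. (h, A h))) (at u)"
    using f by (auto intro!: derivative_eq_intros)
  moreover have "\<forall>\<^sub>F u' in nhds u. u' \<in> UNIV \<longrightarrow> (u', f u') \<in> fun_graph U f"
    using eventually_nhds_in_open[OF assms(1,2)] by eventually_elim (auto simp: fun_graph_def)
  ultimately show "p \<in> tangent_cone (fun_graph U f) (u, f u)"
    unfolding p by (rule tangent_cone_has_derivative[rotated 2])
qed

text \<open>The Lipschitz inequality, divided by \<open>t k\<close>, passes to the limit. It
  excludes nonzero vertical tangent vectors and bounds all derivatives.\<close>

lemma norm_le_if_in_tangent_cone_fun_graph:
  fixes f :: "'a::real_normed_vector \<Rightarrow> 'b::real_normed_vector"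
  assumes "u \<in> U" and lip: "C-lipschitz_on U f"
    and p: "p \<in> tangent_cone (fun_graph U f) (u, f u)"
  shows "norm (snd p) \<le> C * norm (fst p)"
proof -
  obtain t v where t: "\<And>k. t k > 0" and v: "v \<longlonglongrightarrow> p"
    and mem: "\<And>k. (u, f u) + t k *\<^sub>R v k \<in> fun_graph U f"
    using p by (auto simp: tangent_cone_def)
  have "norm (snd (v k)) \<le> C * norm (fst (v k))" for k
  proof -
    have "u + t k *\<^sub>R fst (v k) \<in> U" and eq: "f (u + t k *\<^sub>R fst (v k)) = f u + t k *\<^sub>R snd (v k)"
      using mem[of k] by (auto simp: fun_graph_def plus_prod_def)
    then have "norm (t k *\<^sub>R snd (v k)) \<le> C * norm (t k *\<^sub>R fst (v k))"
      using lipschitz_onD[OF lip _ \<open>u \<in> U\<close>] by (fastforce simp: dist_norm)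
    then have "t k * norm (snd (v k)) \<le> t k * (C * norm (fst (v k)))"
      using t[of k] by (simp add: mult.left_commute)
    then show ?thesis
      using t[of k] by simp
  qed
  moreover have "(\<lambda>k. norm (snd (v k))) \<longlonglongrightarrow> norm (snd p)"
    using v by (intro tendsto_intros)
  moreover have "(\<lambda>k. C * norm (fst (v k))) \<longlonglongrightarrow> C * norm (fst p)"
    using v by (intro tendsto_intros)
  ultimately show ?thesis
    using LIMSEQ_le by blast
qed

text \<open>The vector \<open>(h, A h)\<close> is tangent to the graph, so the bound on tangent
  vectors applies to it.\<close>

lemma has_derivative_lipschitz_bound:
  fixes f :: "'a::real_normed_vector \<Rightarrow> 'b::real_normed_vector"
  assumes "open U" "u \<in> U" "C-lipschitz_on U f" "(f has_derivative A) (at u)"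
  shows "norm (A h) \<le> C * norm h"
  using norm_le_if_in_tangent_cone_fun_graph[OF assms(2,3), of "(h, A h)"]
    tangent_cone_fun_graph[OF assms(1,2,4)] by (auto simp: fun_graph_def)

text \<open>
  The Lipschitz bound makes the tangent cone contain no vertical vectors, so it is the graph of a
  linear map; compactness of the difference quotients upgrades this to Frechet differentiability.
\<close>

lemma has_derivative_if_tangent_cone_subspace:
  fixes f :: "'a::euclidean_space \<Rightarrow> 'b::euclidean_space"
  assumes "open U" "u \<in> U" and lip: "C-lipschitz_on U f"
    and sub: "subspace (tangent_cone (fun_graph U f) (u, f u))"
    and dim: "dim (tangent_cone (fun_graph U f) (u, f u)) = DIM('a)"
  obtains A where "(f has_derivative A) (at u)"
proof -
  define T where "T = tangent_cone (fun_graph U f) (u, f u)"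
  have subT: "subspace T"
    using sub by (simp add: T_def)
  have T_bound: "norm (snd p) \<le> C * norm (fst p)" if "p \<in> T" for p
    using norm_le_if_in_tangent_cone_fun_graph[OF assms(2) lip] that by (simp add: T_def)
  \<comment> \<open>The difference of the two vectors is a vertical vector of \<open>T\<close>,
    which \<open>T_bound\<close> forces to vanish.\<close>
  have uniq: "w = w'" if "(h, w) \<in> T" "(h, w') \<in> T" for h w w'
    using T_bound[OF subspace_diff[OF subT that]] by simp
  then have "inj_on fst (span T)"
    using subT by (auto simp: inj_on_def span_eq_iff[THEN iffD2])
  \<comment> \<open>Injectivity preserves the dimension, so the first projection of \<open>T\<close>
    is the whole space and \<open>T\<close> is the graph of a function.\<close>
  then have "dim (fst ` T) = DIM('a)"
    using dim_image_eq[OF linear_fst, of T] dim by (simp add: T_def)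
  moreover have "subspace (fst ` T)"
    using linear_subspace_image[OF linear_fst subT] .
  ultimately have "fst ` T = UNIV"
    using dim_eq_full[of "fst ` T"] span_eq_iff[of "fst ` T"] by simp
  then have "\<exists>w. (h, w) \<in> T" for h
    by (metis UNIV_I imageE prod.collapse)
  then obtain A where A: "\<And>h. (h, A h) \<in> T"
    by metis
  have "linear A"
  proof (rule linearI)
    show "A (x + y) = A x + A y" for x y
      using subspace_add[OF subT A[of x] A[of y]] A[of "x + y"] by (auto intro: uniq)
    show "A (c *\<^sub>R x) = c *\<^sub>R A x" for c x
      using subspace_scale[OF subT A[of x], of c] A[of "c *\<^sub>R x"] by (auto intro: uniq)
  qed
  then have blA: "bounded_linear A"
    by (simp add: linear_conv_bounded_linear)
  interpret A: bounded_linear A by fact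
  have "(f has_derivative A) (at u)"
  proof (rule ccontr)
    \<comment> \<open>Otherwise there are points \<open>y k\<close> tending to \<open>u\<close> with
      relative error above \<open>e\<close>. Their normalized secants \<open>v k\<close> are bounded
      by the Lipschitz property, and a cluster point is tangent, hence on the graph of
      \<open>A\<close>, which contradicts the error bound.\<close>
    assume "\<not> ?thesis"
    then obtain e where "e > 0"
      and e: "\<And>d. d > 0 \<Longrightarrow> \<exists>y. norm (y - u) < d \<and> norm (f y - f u - A (y - u)) > e * norm (y - u)"
      using blA unfolding has_derivative_at_alt by (meson not_le)
    obtain r where "r > 0" and r: "ball u r \<subseteq> U"
      using assms(1,2) openE by blast
    have "\<exists>y. norm (y - u) < min r (inverse (real (Suc k))) \<and>
        norm (f y - f u - A (y - u)) > e * norm (y - u)" for k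
      using e[of "min r (inverse (real (Suc k)))"] \<open>r > 0\<close> by simp
    then obtain y where y: "\<And>k. norm (y k - u) < min r (inverse (real (Suc k)))"
      and far: "\<And>k. norm (f (y k) - f u - A (y k - u)) > e * norm (y k - u)"
      by metis
    define t where "t k = norm (y k - u)" for k
    define v where "v k = ((y k - u) /\<^sub>R t k, (f (y k) - f u) /\<^sub>R t k)" for k
    have yU: "y k \<in> U" for k
      using y[of k] r by (auto simp: dist_norm norm_minus_commute)
    \<comment> \<open>For \<open>y k = u\<close> the strict inequality \<open>far\<close> would read
      \<open>0 > 0\<close>.\<close>
    have t: "t k > 0" for k
      using far[of k] by (cases "y k = u") (auto simp: t_def A.zero)
    have "norm (t k) \<le> inverse (real (Suc k))" for k
      using y[of k] by (simp add: t_def)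
    then have t0: "t \<longlonglongrightarrow> 0"
      by (intro Lim_null_comparison[OF _ LIMSEQ_inverse_real_of_nat] always_eventually) blast
    have fst_v: "norm (fst (v k)) = 1" for k
      using t[of k] by (simp add: v_def t_def)
    have snd_v: "norm (snd (v k)) \<le> C" for k
    proof -
      have "norm (f (y k) - f u) \<le> C * t k"
        using lipschitz_onD[OF lip yU \<open>u \<in> U\<close>] by (simp add: dist_norm t_def)
      moreover have "norm (snd (v k)) = norm (f (y k) - f u) / t k"
        using t[of k] by (simp add: v_def divide_inverse mult.commute)
      ultimately show ?thesis
        using t[of k] by (simp add: pos_divide_le_eq)
    qed
    have "norm (v k) \<le> 1 + C" for k
      using norm_Pair_le[of "fst (v k)" "snd (v k)"] fst_v[of k] snd_v[of k] by simp
    then have "bounded (range v)"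
      by (intro boundedI[of _ "1 + C"]) auto
    then obtain l s where s: "strict_mono s" and l: "(v \<circ> s) \<longlonglongrightarrow> l"
      using bounded_imp_convergent_subsequence by blast
    have "(u, f u) + t k *\<^sub>R v k \<in> fun_graph U f" for k
      using t[of k] yU[of k] by (simp add: v_def fun_graph_def)
    then have "l \<in> T"
      unfolding T_def tangent_cone_def mem_Collect_eq
      using t LIMSEQ_subseq_LIMSEQ[OF t0 s] l
      by (intro exI[of _ "t \<circ> s"] exI[of _ "v \<circ> s"] conjI allI) simp_all
    then have "snd l = A (fst l)"
      using uniq A by (metis prod.collapse)
    moreover have "e \<le> norm (snd (v k) - A (fst (v k)))" for k
    proof -
      have "snd (v k) - A (fst (v k)) = (f (y k) - f u - A (y k - u)) /\<^sub>R t k"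
        by (simp add: v_def A.scaleR A.diff scaleR_diff_right)
      then have "norm (snd (v k) - A (fst (v k))) = norm (f (y k) - f u - A (y k - u)) / t k"
        using t[of k] by (simp add: divide_inverse mult.commute)
      then show ?thesis
        using far[of k] t[of k] by (simp add: t_def[symmetric] pos_le_divide_eq)
    qed
    then have "e \<le> norm (snd ((v \<circ> s) k) - A (fst ((v \<circ> s) k)))" for k
      by simp
    then have "e \<le> norm (snd l - A (fst l))"
      by (intro LIMSEQ_le_const[OF tendsto_norm[OF tendsto_diff[OF tendsto_snd[OF l] A.tendsto[OF tendsto_fst[OF l]]]]])
        auto
    ultimately show False
      using \<open>e > 0\<close> by simp
  qed
  then show thesis
    by (rule that)
qed

subsection \<open>Bounds for the B-Jacobian\<close>

lemma tendsto_matrix_vector_mult: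
  fixes A :: "'c \<Rightarrow> real^'n^'m"
  assumes "(A \<longlongrightarrow> a) G" "(h \<longlongrightarrow> b) G"
  shows "((\<lambda>x. A x *v h x) \<longlongrightarrow> a *v b) G"
  using assms by (auto simp: matrix_vector_mult_def intro!: vec_tendstoI tendsto_intros)

text \<open>Each entry is a component of the image of a unit axis vector, hence at most
  \<open>C\<close> in absolute value; two sums over indices give the norm. The crude constant
  suffices, as only boundedness of sets of Jacobians is wanted.\<close>

lemma norm_matrix_le_if_bounded:
  fixes A :: "real^'n^'m"
  assumes "\<And>h. norm (A *v h) \<le> C * norm h"
  shows "norm A \<le> real CARD('m) * (real CARD('n) * C)"
proof -
  have "\<bar>A $ i $ j\<bar> \<le> C" for i j
    using order_trans[OF component_le_norm_cart assms, of "axis j 1" i]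
    by (simp add: matrix_vector_mul_component inner_axis norm_axis_1)
  then have "(\<Sum>j\<in>UNIV. \<bar>A $ i $ j\<bar>) \<le> (\<Sum>j::'n\<in>UNIV. C)" for i
    by (intro sum_mono)
  then have "norm (A $ i) \<le> real CARD('n) * C" for i
    using norm_le_l1_cart[of "A $ i"] by (simp add: order_trans)
  then have "(\<Sum>i\<in>UNIV. norm (A $ i)) \<le> (\<Sum>i::'m\<in>UNIV. real CARD('n) * C)"
    by (intro sum_mono)
  moreover have "norm A \<le> (\<Sum>i\<in>UNIV. norm (A $ i))"
    unfolding norm_vec_def by (rule L2_set_le_sum) simp
  ultimately show ?thesis
    by simp
qed

text \<open>The bound holds for derivatives at points of \<open>U\<close> and is closed under limits
  of matrices.\<close>

lemma B_Jacobian_lipschitz_bound: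
  fixes f :: "real^'n \<Rightarrow> real^'m"
  assumes "open U" "C-lipschitz_on U f" "A \<in> B_Jacobian U f u"
  shows "norm (A *v h) \<le> C * norm h"
proof -
  obtain w J where w: "\<And>k. w k \<in> U" and J: "\<And>k. (f has_derivative (\<lambda>h. J k *v h)) (at (w k))"
    and lim: "J \<longlonglongrightarrow> A"
    using assms(3) by (auto simp: B_Jacobian_def)
  have "(\<lambda>k. norm (J k *v h)) \<longlonglongrightarrow> norm (A *v h)"
    using lim by (intro tendsto_norm tendsto_matrix_vector_mult tendsto_const)
  then show ?thesis
    by (rule LIMSEQ_le_const2)
      (use has_derivative_lipschitz_bound[OF assms(1) w assms(2) J] in blast)
qed

subsection \<open>The SC derivative in a Lipschitz chart\<close>

text \<open>These are the chart data for \<open>d = n\<close>, with the derivatives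
  \<open>D\<close>, \<open>E\<close> and the Lipschitz constant fixed by name. No reference point is
  included, so the results hold at every graph point in \<open>W\<close>.\<close>

locale lipschitz_graph_chart =
  fixes F :: "real^'n \<Rightarrow> (real^'m) set"
    and W :: "((real^'n) \<times> (real^'m)) set"
    and \<Phi> :: "(real^'n) \<times> (real^'m) \<Rightarrow> (real^'n) \<times> (real^'m)"
    and U :: "(real^'n) set" and f :: "real^'n \<Rightarrow> real^'m" and C :: real
    and D E :: "(real^'n) \<times> (real^'m) \<Rightarrow> ((real^'n) \<times> (real^'m)) \<Rightarrow>\<^sub>L ((real^'n) \<times> (real^'m))"
  assumes open_W: "open W" and open_image: "open (\<Phi> ` W)" and inj: "inj_on \<Phi> W"
    and \<Phi>_derivative: "z \<in> W \<Longrightarrow> (\<Phi> has_derivative D z) (at z)"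
    and D_continuous: "continuous_on W D"
    and inv_derivative: "p \<in> \<Phi> ` W \<Longrightarrow> (the_inv_into W \<Phi> has_derivative E p) (at p)"
    and E_continuous: "continuous_on (\<Phi> ` W) E"
    and open_U: "open U" and lipschitz: "C-lipschitz_on U f"
    and image_gph: "\<Phi> ` (gph F \<inter> W) = fun_graph U f"
begin

section \<open>The inverse chart and its derivative\<close>

abbreviation "\<Psi> \<equiv> the_inv_into W \<Phi>"

lemma \<Psi>_\<Phi>: "z \<in> W \<Longrightarrow> \<Psi> (\<Phi> z) = z"
  using inj by (rule the_inv_into_f_f)

text \<open>The chain rule for the identity \<open>\<Psi> (\<Phi> x) = x\<close> near
  \<open>z\<close>, combined with uniqueness of derivatives.\<close>

lemma E_D:
  assumes "z \<in> W"
  shows "E (\<Phi> z) (D z v) = v"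
proof -
  have "((\<lambda>x. \<Psi> (\<Phi> x)) has_derivative (\<lambda>v. E (\<Phi> z) (D z v))) (at z)"
    using assms by (intro has_derivative_compose[OF \<Phi>_derivative] inv_derivative) auto
  then have "((\<lambda>x. x) has_derivative (\<lambda>v. E (\<Phi> z) (D z v))) (at z)"
    by (rule has_derivative_transform_within_open[OF _ open_W assms]) (simp add: \<Psi>_\<Phi>)
  from has_derivative_unique[OF this has_derivative_ident] show ?thesis
    by (rule fun_cong)
qed

lemma D_E:
  assumes "z \<in> W"
  shows "D z (E (\<Phi> z) p) = p"
proof -
  have "((\<lambda>p. \<Phi> (\<Psi> p)) has_derivative (\<lambda>p. D z (E (\<Phi> z) p))) (at (\<Phi> z))"
    using \<Phi>_derivative[OF assms] assms
    by (intro has_derivative_compose[OF inv_derivative]) (auto simp: \<Psi>_\<Phi>)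
  then have "((\<lambda>p. p) has_derivative (\<lambda>p. D z (E (\<Phi> z) p))) (at (\<Phi> z))"
    by (rule has_derivative_transform_within_open[OF _ open_image imageI[OF assms]])
      (auto simp: \<Psi>_\<Phi>)
  from has_derivative_unique[OF this has_derivative_ident] show ?thesis
    by (rule fun_cong)
qed

text \<open>\<open>param\<close> and \<open>proj\<close> are mutually inverse between
  \<open>U\<close> and the part of \<open>gph F\<close> in \<open>W\<close>. They exchange sequences
  of graph points with sequences of parameters.\<close>

definition param :: "real^'n \<Rightarrow> (real^'n) \<times> (real^'m)" where
  "param u = \<Psi> (u, f u)"

definition proj :: "(real^'n) \<times> (real^'m) \<Rightarrow> real^'n" where
  "proj z = fst (\<Phi> z)"

lemma
  assumes "z \<in> gph F" "z \<in> W"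
  shows proj_in_U: "proj z \<in> U" and \<Phi>_gph: "\<Phi> z = (proj z, f (proj z))"
    and param_proj: "param (proj z) = z"
proof -
  have "\<Phi> z \<in> fun_graph U f"
    using assms image_gph by blast
  then show "proj z \<in> U" "\<Phi> z = (proj z, f (proj z))"
    by (auto simp: proj_def fun_graph_def)
  then show "param (proj z) = z"
    using \<Psi>_\<Phi>[OF assms(2)] by (simp add: param_def)
qed

lemma
  assumes "u \<in> U"
  shows param_in_gph: "param u \<in> gph F" and param_in_W: "param u \<in> W"
    and \<Phi>_param: "\<Phi> (param u) = (u, f u)" and proj_param: "proj (param u) = u"
proof -
  have "(u, f u) \<in> \<Phi> ` (gph F \<inter> W)"
    using assms image_gph by (auto simp: fun_graph_def)
  then obtain z where z: "z \<in> gph F" "z \<in> W" "\<Phi> z = (u, f u)"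
    by force
  moreover from this have "param u = z"
    using \<Psi>_\<Phi>[OF z(2)] by (simp add: param_def)
  ultimately show "param u \<in> gph F" "param u \<in> W" "\<Phi> (param u) = (u, f u)" "proj (param u) = u"
    by (simp_all add: proj_def)
qed

section \<open>Continuity of the chart, its derivatives and the parametrization\<close>

lemma isCont_\<Phi>: "z \<in> W \<Longrightarrow> isCont \<Phi> z"
  using has_derivative_continuous[OF \<Phi>_derivative] .

lemma isCont_proj: "z \<in> W \<Longrightarrow> isCont proj z"
  unfolding proj_def[abs_def] using isCont_\<Phi> by (intro continuous_intros) auto

lemma isCont_D: "z \<in> W \<Longrightarrow> isCont D z"
  using D_continuous open_W by (simp add: continuous_on_eq_continuous_at)

lemma isCont_E_\<Phi>: "z \<in> W \<Longrightarrow> isCont (\<lambda>z. E (\<Phi> z)) z"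
  by (rule isCont_o2[OF isCont_\<Phi>])
    (use E_continuous open_image in \<open>auto simp: continuous_on_eq_continuous_at\<close>)

lemma isCont_graph:
  assumes "u \<in> U"
  shows "isCont (\<lambda>u. (u, f u)) u"
  using lipschitz_on_continuous_on[OF lipschitz] open_U assms
  by (intro continuous_intros) (auto simp: continuous_on_eq_continuous_at)

lemma isCont_param:
  assumes "u \<in> U"
  shows "isCont param u"
proof -
  have "isCont \<Psi> (u, f u)"
    using inv_derivative[of "(u, f u)"] \<Phi>_param[OF assms] param_in_W[OF assms]
    by (intro has_derivative_continuous) force
  with isCont_graph[OF assms] show ?thesis
    unfolding param_def[abs_def] by (rule isCont_o2)
qed

text \<open>The chart and its inverse both carry tangent vectors to tangent vectors through their
  derivatives; since \<open>D z\<close> and \<open>E (\<Phi> z)\<close> are mutually inverse, the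
  two inclusions become equalities.\<close>

lemma tangent_cone_gph:
  assumes z: "z \<in> gph F" "z \<in> W"
  shows "tangent_cone (gph F) z = E (\<Phi> z) ` tangent_cone (fun_graph U f) (\<Phi> z)"
    and "tangent_cone (fun_graph U f) (\<Phi> z) = D z ` tangent_cone (gph F) z"
proof -
  have 1: "D z w \<in> tangent_cone (fun_graph U f) (\<Phi> z)" if "w \<in> tangent_cone (gph F) z" for w
  proof (rule tangent_cone_has_derivative[OF \<Phi>_derivative[OF z(2)] _ that])
    show "\<forall>\<^sub>F z' in nhds z. z' \<in> gph F \<longrightarrow> \<Phi> z' \<in> fun_graph U f"
      using eventually_nhds_in_open[OF open_W z(2)]
      by eventually_elim (use image_gph in blast)
  qed
  have 2: "E (\<Phi> z) p \<in> tangent_cone (gph F) z" if "p \<in> tangent_cone (fun_graph U f) (\<Phi> z)" for p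
  proof -
    have "\<forall>\<^sub>F p in nhds (\<Phi> z). p \<in> fun_graph U f \<longrightarrow> \<Psi> p \<in> gph F"
      using param_in_gph by (intro always_eventually) (auto simp: fun_graph_def param_def)
    from tangent_cone_has_derivative[OF inv_derivative this that] show ?thesis
      using z(2) by (simp add: \<Psi>_\<Phi>)
  qed
  show "tangent_cone (gph F) z = E (\<Phi> z) ` tangent_cone (fun_graph U f) (\<Phi> z)"
  proof (intro equalityI subsetI)
    fix w assume "w \<in> tangent_cone (gph F) z"
    then show "w \<in> E (\<Phi> z) ` tangent_cone (fun_graph U f) (\<Phi> z)"
      using 1 by (intro image_eqI[where x = "D z w"]) (simp_all add: E_D[OF z(2)])
  qed (use 2 in blast)
  show "tangent_cone (fun_graph U f) (\<Phi> z) = D z ` tangent_cone (gph F) z"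
  proof (intro equalityI subsetI)
    fix p assume "p \<in> tangent_cone (fun_graph U f) (\<Phi> z)"
    then show "p \<in> D z ` tangent_cone (gph F) z"
      using 2 by (intro image_eqI[where x = "E (\<Phi> z) p"]) (simp_all add: D_E[OF z(2)])
  qed (use 1 in blast)
qed

text \<open>The preimage under \<open>D z\<close> of the graph of \<open>A\<close>. Written as an
  equation it passes to limits easily; the image form \<open>pullback_eq_image\<close> gives the
  dimension and explicit elements.\<close>

definition pullback :: "(real^'n) \<times> (real^'m) \<Rightarrow> real^'n^'m \<Rightarrow> ((real^'n) \<times> (real^'m)) set" where
  "pullback z A = {w. snd (D z w) = A *v fst (D z w)}"

lemma pullback_eq_image:
  assumes "z \<in> W"
  shows "pullback z A = range (\<lambda>h. E (\<Phi> z) (h, A *v h))"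
proof (intro equalityI subsetI)
  fix w assume "w \<in> pullback z A"
  then have "D z w = (fst (D z w), A *v fst (D z w))"
    by (simp add: pullback_def prod_eq_iff)
  then have "w = E (\<Phi> z) (fst (D z w), A *v fst (D z w))"
    using E_D[OF assms, of w] by simp
  then show "w \<in> range (\<lambda>h. E (\<Phi> z) (h, A *v h))"
    by blast
qed (auto simp: pullback_def D_E[OF assms])

lemma pullback_in_n_subspaces:
  assumes "z \<in> W"
  shows "pullback z A \<in> n_subspaces"
proof -
  have lin: "linear (\<lambda>h. E (\<Phi> z) (h, A *v h))"
    by (intro linearI) (simp_all add: matrix_vector_right_distrib matrix_vector_mult_scaleR
        flip: blinfun.add_right blinfun.scaleR_right)
  have "inj (\<lambda>h. E (\<Phi> z) (h, A *v h))"
  proof (rule injI)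
    fix x y assume "E (\<Phi> z) (x, A *v x) = E (\<Phi> z) (y, A *v y)"
    then have "D z (E (\<Phi> z) (x, A *v x)) = D z (E (\<Phi> z) (y, A *v y))"
      by simp
    then show "x = y"
      by (simp add: D_E[OF assms])
  qed
  then have "dim (pullback z A) = CARD('n)"
    using dim_image_eq[OF lin, of UNIV] by (simp add: pullback_eq_image[OF assms])
  moreover have "subspace (pullback z A)"
    using linear_subspace_image[OF lin subspace_UNIV] by (simp add: pullback_eq_image[OF assms])
  ultimately show ?thesis
    by (simp add: n_subspaces_def)
qed

lemma tangent_cone_gph_eq_pullback:
  assumes z: "z \<in> gph F" "z \<in> W" and J: "(f has_derivative (\<lambda>h. J *v h)) (at (proj z))"
  shows "tangent_cone (gph F) z = pullback z J"
  using tangent_cone_gph(1)[OF z] tangent_cone_fun_graph[OF open_U proj_in_U[OF z] J]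
  by (auto simp: pullback_eq_image[OF z(2)] \<Phi>_gph[OF z] fun_graph_def)

text \<open>The isomorphism \<open>D z\<close> transfers subspace structure and dimension to the
  tangent cone of the graph of \<open>f\<close>, where the Lipschitz criterion for differentiability
  applies.\<close>

lemma smooth_point_has_derivative:
  assumes z: "z \<in> smooth_points F" "z \<in> W"
  obtains J where "(f has_derivative (\<lambda>h. J *v h)) (at (proj z))"
proof -
  have gph: "z \<in> gph F" and sub: "subspace (tangent_cone (gph F) z)"
    and dim: "dim (tangent_cone (gph F) z) = CARD('n)"
    using z(1) by (auto simp: smooth_points_def n_subspaces_def)
  note T = tangent_cone_gph(2)[OF gph z(2)]
  have "inj (D z)"
    using E_D[OF z(2)] by (metis injI)
  then have "dim (tangent_cone (fun_graph U f) (\<Phi> z)) = DIM(real^'n)"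
    using dim_image_eq[OF bounded_linear.linear[OF blinfun.bounded_linear_right], of "D z" "tangent_cone (gph F) z"]
      dim T by (simp add: inj_on_subset)
  moreover have "subspace (tangent_cone (fun_graph U f) (\<Phi> z))"
    unfolding T using sub by (intro linear_subspace_image bounded_linear.linear[OF blinfun.bounded_linear_right])
  ultimately obtain A where A: "(f has_derivative A) (at (proj z))"
    using has_derivative_if_tangent_cone_subspace[OF open_U proj_in_U[OF gph z(2)] lipschitz]
    by (auto simp: \<Phi>_gph[OF gph z(2)])
  then have "(f has_derivative (\<lambda>h. matrix A *v h)) (at (proj z))"
    by (simp add: matrix_works has_derivative_bounded_linear bounded_linear.linear)
  then show thesis
    by (rule that)
qed

text \<open>Points \<open>w k\<close> with Jacobians \<open>J k\<close> tending to \<open>A\<close>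
  are lifted by \<open>param\<close> to smooth points of \<open>F\<close>. The tangent cones there
  are pullbacks of \<open>J k\<close>, which converge to the pullback of \<open>A\<close>.\<close>

lemma pullback_in_SC_derivative:
  assumes z: "z \<in> gph F" "z \<in> W" and A: "A \<in> B_Jacobian U f (proj z)"
  shows "pullback z A \<in> SC_derivative F z"
proof -
  obtain w J where w: "\<And>k. w k \<in> U" "w \<longlonglongrightarrow> proj z"
    and J: "\<And>k. (f has_derivative (\<lambda>h. J k *v h)) (at (w k))" "J \<longlonglongrightarrow> A"
    using A by (auto simp: B_Jacobian_def)
  define \<zeta> where "\<zeta> k = param (w k)" for k
  have \<zeta>: "\<zeta> k \<in> gph F" "\<zeta> k \<in> W" "proj (\<zeta> k) = w k" for k
    by (simp_all add: \<zeta>_def param_in_gph param_in_W proj_param w(1))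
  have \<zeta>_lim: "\<zeta> \<longlonglongrightarrow> z"
    using isCont_tendsto_compose[OF isCont_param[OF proj_in_U[OF z]] w(2)]
    by (simp add: \<zeta>_def[abs_def] param_proj[OF z])
  have T: "tangent_cone (gph F) (\<zeta> k) = pullback (\<zeta> k) (J k)" for k
    using tangent_cone_gph_eq_pullback[OF \<zeta>(1,2)] J(1) by (simp add: \<zeta>(3))
  have D_lim: "(\<lambda>k. D (\<zeta> k)) \<longlonglongrightarrow> D z" and E_lim: "(\<lambda>k. E (\<Phi> (\<zeta> k))) \<longlonglongrightarrow> E (\<Phi> z)"
    using isCont_tendsto_compose[OF isCont_D[OF z(2)] \<zeta>_lim]
      isCont_tendsto_compose[OF isCont_E_\<Phi>[OF z(2)] \<zeta>_lim] .
  have sub: "subspace (pullback z' A')" if "z' \<in> W" for z' A'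
    using pullback_in_n_subspaces[OF that] by (simp add: n_subspaces_def)
  have "(\<lambda>k. subspace_dist (pullback z A) (pullback (\<zeta> k) (J k))) \<longlonglongrightarrow> 0"
  proof (rule subspace_dist_tendsto_0I)
    \<comment> \<open>Outer limits: the equation defining \<open>pullback\<close> survives the limit
      because \<open>D\<close> is continuous and \<open>J\<close> converges.\<close>
    fix r p l
    assume r: "strict_mono r" and p: "\<And>k. p k \<in> pullback (\<zeta> (r k)) (J (r k))" "p \<longlonglongrightarrow> l"
    have Dp: "(\<lambda>k. D (\<zeta> (r k)) (p k)) \<longlonglongrightarrow> D z l"
      using LIMSEQ_subseq_LIMSEQ[OF D_lim r] p(2) by (intro blinfun.tendsto) (simp_all add: o_def)
    have "(\<lambda>k. J (r k) *v fst (D (\<zeta> (r k)) (p k))) \<longlonglongrightarrow> A *v fst (D z l)"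
      using LIMSEQ_subseq_LIMSEQ[OF J(2) r] tendsto_fst[OF Dp]
      by (intro tendsto_matrix_vector_mult) (simp_all add: o_def)
    moreover have "(\<lambda>k. J (r k) *v fst (D (\<zeta> (r k)) (p k))) \<longlonglongrightarrow> snd (D z l)"
      using tendsto_snd[OF Dp] p(1) by (simp add: pullback_def)
    ultimately show "l \<in> pullback z A"
      using LIMSEQ_unique by (auto simp: pullback_def)
  next
    \<comment> \<open>Inner limits: in the image form, the same parameter \<open>h\<close> with
      \<open>J k\<close> in place of \<open>A\<close> gives the approximating vectors.\<close>
    fix l assume "l \<in> pullback z A"
    then obtain h where l: "l = E (\<Phi> z) (h, A *v h)"
      using pullback_eq_image[OF z(2)] by blast
    have "(\<lambda>k. E (\<Phi> (\<zeta> k)) (h, J k *v h)) \<longlonglongrightarrow> l"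
      unfolding l using E_lim J(2)
      by (intro blinfun.tendsto tendsto_Pair tendsto_const tendsto_matrix_vector_mult)
    moreover have "E (\<Phi> (\<zeta> k)) (h, J k *v h) \<in> pullback (\<zeta> k) (J k)" for k
      using pullback_eq_image[OF \<zeta>(2)] by blast
    ultimately show "\<exists>p. (\<forall>k. p k \<in> pullback (\<zeta> k) (J k)) \<and> p \<longlonglongrightarrow> l"
      by (intro exI[of _ "\<lambda>k. E (\<Phi> (\<zeta> k)) (h, J k *v h)"]) simp
  qed (use sub z \<zeta> in auto)
  moreover have "\<zeta> k \<in> smooth_points F" for k
    using \<zeta>(1,2) T pullback_in_n_subspaces by (simp add: smooth_points_def)
  ultimately show ?thesis
    unfolding SC_derivative_def using pullback_in_n_subspaces[OF z(2)] \<zeta>_lim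
    by (auto simp: T intro!: exI[of _ \<zeta>])
qed

text \<open>The Jacobians at the approximating smooth points are bounded by the Lipschitz property,
  so a subsequence converges to some \<open>A\<close> in the B-Jacobian, and this \<open>A\<close>
  represents \<open>L\<close>.\<close>

lemma SC_derivative_subset:
  assumes z: "z \<in> gph F" "z \<in> W" and L: "L \<in> SC_derivative F z"
  obtains A where "A \<in> B_Jacobian U f (proj z)" "L = pullback z A"
proof -
  obtain \<zeta>0 where L_sub: "L \<in> n_subspaces" and \<zeta>0: "\<And>k. \<zeta>0 k \<in> smooth_points F" "\<zeta>0 \<longlonglongrightarrow> z"
    and dist0: "(\<lambda>k. subspace_dist L (tangent_cone (gph F) (\<zeta>0 k))) \<longlonglongrightarrow> 0"
    using L by (auto simp: SC_derivative_def)
  have "\<forall>\<^sub>F k in sequentially. \<zeta>0 k \<in> W"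
    using topological_tendstoD[OF \<zeta>0(2) open_W z(2)] .
  \<comment> \<open>The smooth points lie in \<open>W\<close> only eventually; the shift by
    \<open>N\<close> makes the chart available at every index.\<close>
  then obtain N where N: "\<And>k. k \<ge> N \<Longrightarrow> \<zeta>0 k \<in> W"
    by (auto simp: eventually_sequentially)
  define \<zeta>1 where "\<zeta>1 k = \<zeta>0 (k + N)" for k
  have \<zeta>1: "\<zeta>1 k \<in> smooth_points F" "\<zeta>1 k \<in> W" for k
    by (simp_all add: \<zeta>1_def \<zeta>0(1) N)
  have \<zeta>1_lim: "\<zeta>1 \<longlonglongrightarrow> z"
    and dist1: "(\<lambda>k. subspace_dist L (tangent_cone (gph F) (\<zeta>1 k))) \<longlonglongrightarrow> 0"
    using LIMSEQ_ignore_initial_segment[OF \<zeta>0(2), of N] LIMSEQ_ignore_initial_segment[OF dist0, of N]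
    by (simp_all add: \<zeta>1_def[abs_def])
  have "\<exists>J. (f has_derivative (\<lambda>h. J *v h)) (at (proj (\<zeta>1 k)))" for k
    by (rule smooth_point_has_derivative[OF \<zeta>1]) blast
  then obtain J1 where J1: "\<And>k. (f has_derivative (\<lambda>h. J1 k *v h)) (at (proj (\<zeta>1 k)))"
    by metis
  have \<zeta>1_gph: "\<zeta>1 k \<in> gph F" for k
    using \<zeta>1(1) by (simp add: smooth_points_def)
  have "norm (J1 k) \<le> real CARD('m) * (real CARD('n) * C)" for k
    using has_derivative_lipschitz_bound[OF open_U proj_in_U[OF \<zeta>1_gph \<zeta>1(2)] lipschitz J1]
    by (intro norm_matrix_le_if_bounded)
  then have "bounded (range J1)"
    by (auto intro: boundedI)
  then obtain A r where r: "strict_mono r" and A: "(J1 \<circ> r) \<longlonglongrightarrow> A"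
    using bounded_imp_convergent_subsequence by blast
  define \<zeta> where "\<zeta> = \<zeta>1 \<circ> r"
  define J where "J = J1 \<circ> r"
  have \<zeta>: "\<zeta> k \<in> gph F" "\<zeta> k \<in> W" for k
    by (simp_all add: \<zeta>_def \<zeta>1_gph \<zeta>1(2))
  have \<zeta>_lim: "\<zeta> \<longlonglongrightarrow> z" and J: "J \<longlonglongrightarrow> A"
    using LIMSEQ_subseq_LIMSEQ[OF \<zeta>1_lim r] A by (simp_all add: \<zeta>_def J_def)
  have deriv: "(f has_derivative (\<lambda>h. J k *v h)) (at (proj (\<zeta> k)))" for k
    using J1 by (simp add: J_def \<zeta>_def)
  have T: "tangent_cone (gph F) (\<zeta> k) = pullback (\<zeta> k) (J k)" for k
    by (rule tangent_cone_gph_eq_pullback[OF \<zeta> deriv])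
  have dist: "(\<lambda>k. subspace_dist L (pullback (\<zeta> k) (J k))) \<longlonglongrightarrow> 0"
    using LIMSEQ_subseq_LIMSEQ[OF dist1 r] T by (simp add: \<zeta>_def o_def)
  have sub: "subspace (pullback (\<zeta> k) (J k))" for k
    using pullback_in_n_subspaces[OF \<zeta>(2)] by (simp add: n_subspaces_def)
  have "(\<lambda>k. proj (\<zeta> k)) \<longlonglongrightarrow> proj z"
    by (rule isCont_tendsto_compose[OF isCont_proj[OF z(2)] \<zeta>_lim])
  then have "A \<in> B_Jacobian U f (proj z)"
    using deriv J proj_in_U[OF \<zeta>] proj_in_U[OF z] unfolding B_Jacobian_def
    by (auto intro!: exI[of _ "\<lambda>k. proj (\<zeta> k)"] exI[of _ J])
  \<comment> \<open>One inclusion is enough, since both subspaces have dimension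
    \<open>CARD('n)\<close>. Projecting \<open>w\<close> onto the approximating tangent cones gives
    tangent vectors that converge to \<open>w\<close>.\<close>
  moreover have "L \<subseteq> pullback z A"
  proof
    fix w assume "w \<in> L"
    define p where "p k = orth_projection (pullback (\<zeta> k) (J k)) w" for k
    have "p \<longlonglongrightarrow> w"
      unfolding p_def[abs_def] using L_sub sub \<open>w \<in> L\<close> dist
      by (intro subspace_dist_tendsto_imp_orth_projection_tendsto[of L]) (auto simp: n_subspaces_def)
    then have Dp: "(\<lambda>k. D (\<zeta> k) (p k)) \<longlonglongrightarrow> D z w"
      using isCont_tendsto_compose[OF isCont_D[OF z(2)] \<zeta>_lim] by (intro blinfun.tendsto)
    have "p k \<in> pullback (\<zeta> k) (J k)" for k
      unfolding p_def by (rule orth_projection_in[OF sub])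
    then have "(\<lambda>k. J k *v fst (D (\<zeta> k) (p k))) \<longlonglongrightarrow> snd (D z w)"
      using tendsto_snd[OF Dp] by (simp add: pullback_def)
    moreover have "(\<lambda>k. J k *v fst (D (\<zeta> k) (p k))) \<longlonglongrightarrow> A *v fst (D z w)"
      by (rule tendsto_matrix_vector_mult[OF J tendsto_fst[OF Dp]])
    ultimately show "w \<in> pullback z A"
      using LIMSEQ_unique by (auto simp: pullback_def)
  qed
  then have "L = pullback z A"
    using L_sub pullback_in_n_subspaces[OF z(2), of A]
    by (intro subspace_dim_equal) (auto simp: n_subspaces_def)
  ultimately show thesis
    by (rule that)
qed

lemma SC_derivative_eq:
  assumes "z \<in> gph F" "z \<in> W"
  shows "SC_derivative F z = pullback z ` B_Jacobian U f (proj z)"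
  using pullback_in_SC_derivative[OF assms] by (auto elim: SC_derivative_subset[OF assms])

end

subsection \<open>Metric reformulations of the two semismoothness notions\<close>

text \<open>Duality for the distance to a subspace: one direction is Cauchy-Schwarz, the other tests
  the bound with the residual \<open>q - l\<close> of the orthogonal projection.\<close>

lemma ex_near_iff_orthogonal_comp_bound:
  fixes L :: "'a::euclidean_space set"
  assumes "subspace L" "c \<ge> 0"
  shows "(\<exists>l\<in>L. norm (q - l) \<le> c) \<longleftrightarrow> (\<forall>p\<in>orthogonal_comp L. \<bar>p \<bullet> q\<bar> \<le> c * norm p)"
proof
  assume "\<exists>l\<in>L. norm (q - l) \<le> c"
  then obtain l where l: "l \<in> L" "norm (q - l) \<le> c"
    by blast
  show "\<forall>p\<in>orthogonal_comp L. \<bar>p \<bullet> q\<bar> \<le> c * norm p"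
  proof
    fix p assume "p \<in> orthogonal_comp L"
    then have "p \<bullet> q = p \<bullet> (q - l)"
      using l(1) by (simp add: orthogonal_comp_def orthogonal_def inner_diff_right inner_commute)
    also have "\<bar>\<dots>\<bar> \<le> norm p * norm (q - l)"
      by (rule Cauchy_Schwarz_ineq2)
    also have "\<dots> \<le> c * norm p"
      using mult_left_mono[OF l(2), of "norm p"] by (simp add: mult.commute)
    finally show "\<bar>p \<bullet> q\<bar> \<le> c * norm p" .
  qed
next
  assume bound: "\<forall>p\<in>orthogonal_comp L. \<bar>p \<bullet> q\<bar> \<le> c * norm p"
  define l where "l = orth_projection L q"
  have l: "l \<in> L" "q - l \<in> orthogonal_comp L"
    using assms by (simp_all add: l_def orth_projection_in orth_projection_residual)
  then have "(q - l) \<bullet> l = 0"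
    by (simp add: orthogonal_comp_def orthogonal_def inner_commute)
  then have "(q - l) \<bullet> q = (q - l) \<bullet> (q - l)"
    using inner_diff_right[of "q - l" q l] by simp
  also have "\<dots> = norm (q - l) * norm (q - l)"
    by (simp add: power2_eq_square flip: power2_norm_eq_inner)
  finally have "(q - l) \<bullet> q = norm (q - l) * norm (q - l)" .
  then have "norm (q - l) * norm (q - l) \<le> c * norm (q - l)"
    using bspec[OF bound l(2)] by simp
  then have "norm (q - l) \<le> c"
    using assms(2) by (cases "q = l") (auto dest: mult_right_le_imp_le)
  then show "\<exists>l\<in>L. norm (q - l) \<le> c"
    using l(1) by blast
qed

text \<open>A pair \<open>(ystar, xstar)\<close> comes from the normal vector
  \<open>(xstar, - ystar)\<close>. The sign change preserves the norm and turns the difference of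
  pairings into an inner product with \<open>q\<close>.\<close>

lemma adjoint_SC_derivative_bound_iff:
  "(\<forall>(ystar, xstar) \<in> \<Union> (adjoint_SC_derivative F z).
      \<bar>xstar \<bullet> fst q - ystar \<bullet> snd q\<bar> \<le> c * norm (ystar, xstar)) \<longleftrightarrow>
   (\<forall>L\<in>SC_derivative F z. \<forall>p\<in>orthogonal_comp L. \<bar>p \<bullet> q\<bar> \<le> c * norm p)"
proof -
  have norm: "norm (- v, u) = norm (u, v)" for u :: "real^'n" and v :: "real^'m"
    by (simp add: norm_Pair add.commute)
  have members: "(ystar, xstar) \<in> \<Union> (adjoint_SC_derivative F z) \<longleftrightarrow>
      (\<exists>L\<in>SC_derivative F z. (xstar, - ystar) \<in> orthogonal_comp L)" for ystar xstar
    by (force simp: adjoint_SC_derivative_def adjoint_subspace_def)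
  have "(\<forall>(ystar, xstar) \<in> \<Union> (adjoint_SC_derivative F z).
        \<bar>xstar \<bullet> fst q - ystar \<bullet> snd q\<bar> \<le> c * norm (ystar, xstar)) \<longleftrightarrow>
      (\<forall>L\<in>SC_derivative F z. \<forall>ystar xstar. (xstar, - ystar) \<in> orthogonal_comp L \<longrightarrow>
        \<bar>xstar \<bullet> fst q - ystar \<bullet> snd q\<bar> \<le> c * norm (ystar, xstar))"
    unfolding Ball_def split_paired_All case_prod_conv members by blast
  also have "\<dots> \<longleftrightarrow> (\<forall>L\<in>SC_derivative F z. \<forall>v u. (u, v) \<in> orthogonal_comp L \<longrightarrow>
        \<bar>(u, v) \<bullet> q\<bar> \<le> c * norm (u, v))"
    by (metis (no_types, lifting) add.inverse_inverse diff_minus_eq_add inner_minus_left inner_prod_def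
        fst_conv snd_conv norm)
  finally show ?thesis
    by auto
qed

lemma eventually_nhds_norm_le:
  "eventually P (nhds a) \<longleftrightarrow> (\<exists>\<delta>>0. \<forall>x. norm (x - a) \<le> \<delta> \<longrightarrow> P x)"
  for a :: "'a::real_normed_vector"
  by (simp add: eventually_nhds_metric_le dist_norm)

text \<open>By the duality above, the estimate over adjoint subspaces becomes closeness of
  \<open>z - z\<^sub>0\<close> to each subspace in the SC derivative.\<close>

lemma SCD_ss_star_iff:
  "SCD_ss_star F z\<^sub>0 \<longleftrightarrow>
     z\<^sub>0 \<in> gph F \<and> (\<forall>\<^sub>F z in nhds z\<^sub>0. z \<in> gph F \<longrightarrow> SC_derivative F z \<noteq> {}) \<and>
     (\<forall>\<epsilon>>0. \<forall>\<^sub>F z in nhds z\<^sub>0. z \<in> gph F \<longrightarrow>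
        (\<forall>L\<in>SC_derivative F z. \<exists>l\<in>L. norm (z - z\<^sub>0 - l) \<le> \<epsilon> * norm (z - z\<^sub>0)))"
proof -
  have "(\<exists>N. open N \<and> z\<^sub>0 \<in> N \<and> (\<forall>z \<in> gph F \<inter> N. adjoint_SC_derivative F z \<noteq> {})) \<longleftrightarrow>
      (\<forall>\<^sub>F z in nhds z\<^sub>0. z \<in> gph F \<longrightarrow> SC_derivative F z \<noteq> {})"
    unfolding eventually_nhds adjoint_SC_derivative_def by blast
  moreover have "(\<exists>\<delta>>0. \<forall>(x, y) \<in> gph F. norm ((x, y) - z\<^sub>0) \<le> \<delta> \<longrightarrow>
        (\<forall>(ystar, xstar) \<in> \<Union> (adjoint_SC_derivative F (x, y)).
          \<bar>xstar \<bullet> (x - fst z\<^sub>0) - ystar \<bullet> (y - snd z\<^sub>0)\<bar>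
            \<le> \<epsilon> * norm ((x, y) - z\<^sub>0) * norm (ystar, xstar))) \<longleftrightarrow>
      (\<forall>\<^sub>F z in nhds z\<^sub>0. z \<in> gph F \<longrightarrow>
        (\<forall>L\<in>SC_derivative F z. \<exists>l\<in>L. norm (z - z\<^sub>0 - l) \<le> \<epsilon> * norm (z - z\<^sub>0)))"
    if "\<epsilon> > 0" for \<epsilon>
  proof -
    have pointwise: "(\<forall>(ystar, xstar) \<in> \<Union> (adjoint_SC_derivative F (x, y)).
          \<bar>xstar \<bullet> (x - fst z\<^sub>0) - ystar \<bullet> (y - snd z\<^sub>0)\<bar>
            \<le> \<epsilon> * norm ((x, y) - z\<^sub>0) * norm (ystar, xstar)) \<longleftrightarrow>
        (\<forall>L\<in>SC_derivative F (x, y). \<exists>l\<in>L. norm ((x, y) - z\<^sub>0 - l) \<le> \<epsilon> * norm ((x, y) - z\<^sub>0))" for x y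
    proof -
      have sub: "subspace L" if "L \<in> SC_derivative F (x, y)" for L
        using that by (simp add: SC_derivative_def n_subspaces_def)
      have "(\<exists>l\<in>L. norm ((x, y) - z\<^sub>0 - l) \<le> \<epsilon> * norm ((x, y) - z\<^sub>0)) \<longleftrightarrow>
          (\<forall>p\<in>orthogonal_comp L. \<bar>p \<bullet> ((x, y) - z\<^sub>0)\<bar> \<le> \<epsilon> * norm ((x, y) - z\<^sub>0) * norm p)"
        if "L \<in> SC_derivative F (x, y)" for L
        using \<open>\<epsilon> > 0\<close> by (intro ex_near_iff_orthogonal_comp_bound sub[OF that]) simp
      then show ?thesis
        using adjoint_SC_derivative_bound_iff[of F "(x, y)" "(x, y) - z\<^sub>0" "\<epsilon> * norm ((x, y) - z\<^sub>0)"]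
        by simp
    qed
    have paired: "(\<forall>(x, y) \<in> S. norm ((x, y) - z\<^sub>0) \<le> \<delta> \<longrightarrow> R (x, y)) \<longleftrightarrow>
        (\<forall>z. norm (z - z\<^sub>0) \<le> \<delta> \<longrightarrow> z \<in> S \<longrightarrow> R z)" for S \<delta> R
      by auto
    show ?thesis
      unfolding pointwise eventually_nhds_norm_le
        paired[where R = "\<lambda>z. \<forall>L\<in>SC_derivative F z. \<exists>l\<in>L. norm (z - z\<^sub>0 - l) \<le> \<epsilon> * norm (z - z\<^sub>0)"] ..
  qed
  ultimately show ?thesis
    unfolding SCD_ss_star_def by simp
qed

section \<open>Semismoothness as a uniform estimate\<close>

lemma bounded_linear_matrix_vector_mult_left:
  "bounded_linear (\<lambda>A::real^'n^'m. A *v x)"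
  by (simp add: linear_conv_bounded_linear[symmetric] linearI matrix_vector_mult_add_rdistrib
      scaleR_matrix_vector_assoc)

text \<open>Here \<open>\<Psi>\<close> is a multifunction, not the inverse chart. Near
  \<open>u\<^sub>0\<close> its values are nonempty and bounded, so the supremum can be traded for a
  bound on each element.\<close>

lemma semismooth_wrt_iff:
  fixes f :: "real^'n \<Rightarrow> real^'m"
  assumes "open U" "u\<^sub>0 \<in> U"
    and bounded: "open N" "u\<^sub>0 \<in> N" "bounded (\<Union>u\<in>N. \<Psi> u)"
  shows "semismooth_wrt U f \<Psi> u\<^sub>0 \<longleftrightarrow>
    (\<forall>\<^sub>F u in nhds u\<^sub>0. \<Psi> u \<noteq> {}) \<and>
    (\<forall>\<epsilon>>0. \<forall>\<^sub>F u in nhds u\<^sub>0. \<forall>A\<in>\<Psi> u. norm (f u - f u\<^sub>0 - A *v (u - u\<^sub>0)) \<le> \<epsilon> * norm (u - u\<^sub>0))"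
    (is "_ \<longleftrightarrow> ?ne \<and> ?est")
proof -
  let ?r = "\<lambda>u A. norm (f u - f u\<^sub>0 - A *v (u - u\<^sub>0))"
  have dom: "u\<^sub>0 \<in> interior (mdom \<Psi>) \<longleftrightarrow> ?ne"
    by (auto simp: interior_def mdom_def eventually_nhds)
  have bdd: "bdd_above (?r u ` \<Psi> u)" if "u \<in> N" for u
  proof -
    have "bounded (\<Psi> u)"
      using bounded(3) that by (auto intro: bounded_subset)
    then have "bounded ((\<lambda>A. f u - f u\<^sub>0 - A *v (u - u\<^sub>0)) ` \<Psi> u)"
      using bounded_translation[of "(\<lambda>A. - (A *v (u - u\<^sub>0))) ` \<Psi> u" "f u - f u\<^sub>0"]
        bounded_linear_image[OF _ bounded_linear_minus[OF bounded_linear_matrix_vector_mult_left[of "u - u\<^sub>0"]],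
          of "\<Psi> u"]
      by (simp add: image_image del: bounded_uminus)
    then show ?thesis
      by (auto simp: bounded_iff bdd_above_def)
  qed
  have "((\<lambda>u. (SUP A\<in>\<Psi> u. ?r u A) / norm (u - u\<^sub>0)) \<longlongrightarrow> 0) (at u\<^sub>0 within U) \<longleftrightarrow> ?est" if ?ne
  proof
    assume "((\<lambda>u. (SUP A\<in>\<Psi> u. ?r u A) / norm (u - u\<^sub>0)) \<longlongrightarrow> 0) (at u\<^sub>0 within U)"
    then have lim: "((\<lambda>u. (SUP A\<in>\<Psi> u. ?r u A) / norm (u - u\<^sub>0)) \<longlongrightarrow> 0) (at u\<^sub>0)"
      unfolding at_within_open[OF assms(2,1)] .
    show ?est
    proof (intro allI impI)
      fix \<epsilon> :: real assume "\<epsilon> > 0"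
      then have "\<forall>\<^sub>F u in at u\<^sub>0. (SUP A\<in>\<Psi> u. ?r u A) / norm (u - u\<^sub>0) < \<epsilon>"
        by (rule order_tendstoD(2)[OF lim])
      then have "\<forall>\<^sub>F u in nhds u\<^sub>0. u \<noteq> u\<^sub>0 \<longrightarrow> (SUP A\<in>\<Psi> u. ?r u A) / norm (u - u\<^sub>0) < \<epsilon>"
        by (simp add: eventually_at_filter)
      then show "\<forall>\<^sub>F u in nhds u\<^sub>0. \<forall>A\<in>\<Psi> u. ?r u A \<le> \<epsilon> * norm (u - u\<^sub>0)"
        using eventually_nhds_in_open[OF bounded(1,2)]
      proof eventually_elim
        case (elim u)
        show ?case
        proof
          fix A assume "A \<in> \<Psi> u"
          then have "?r u A \<le> (SUP A\<in>\<Psi> u. ?r u A)"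
            by (rule cSUP_upper) (rule bdd[OF elim(2)])
          \<comment> \<open>The limit says nothing at \<open>u = u\<^sub>0\<close>, but there both
            sides are zero.\<close>
          then show "?r u A \<le> \<epsilon> * norm (u - u\<^sub>0)"
            using elim(1) by (cases "u = u\<^sub>0") (auto simp: pos_divide_less_eq)
        qed
      qed
    qed
  next
    assume est: ?est
    have "((\<lambda>u. (SUP A\<in>\<Psi> u. ?r u A) / norm (u - u\<^sub>0)) \<longlongrightarrow> 0) (at u\<^sub>0)"
    proof (rule tendstoI)
      fix \<epsilon> :: real assume "\<epsilon> > 0"
      \<comment> \<open>Half of \<epsilon> leaves room for the strict inequality in the definition
        of the limit.\<close>
      then have "\<forall>\<^sub>F u in nhds u\<^sub>0. \<forall>A\<in>\<Psi> u. ?r u A \<le> \<epsilon> / 2 * norm (u - u\<^sub>0)"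
        using est half_gt_zero by blast
      then have "\<forall>\<^sub>F u in nhds u\<^sub>0. u \<noteq> u\<^sub>0 \<longrightarrow> dist ((SUP A\<in>\<Psi> u. ?r u A) / norm (u - u\<^sub>0)) 0 < \<epsilon>"
        using that eventually_nhds_in_open[OF bounded(1,2)]
      proof eventually_elim
        case (elim u)
        have "(SUP A\<in>\<Psi> u. ?r u A) \<le> \<epsilon> / 2 * norm (u - u\<^sub>0)"
          using elim(1,2) by (intro cSUP_least) auto
        \<comment> \<open>A member of \<open>\<Psi> u\<close> shows that the supremum is
          nonnegative, so the distance of the quotient from 0 is the quotient itself.\<close>
        moreover obtain A where "A \<in> \<Psi> u"
          using elim(2) by blast
        then have "0 \<le> (SUP A\<in>\<Psi> u. ?r u A)"
          by (rule cSUP_upper2[OF bdd[OF elim(3)]]) simp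
        ultimately show ?case
          using \<open>\<epsilon> > 0\<close> by (auto simp: pos_divide_less_eq)
            (smt (verit) mult_pos_pos zero_less_norm_iff right_minus_eq field_sum_of_halves distrib_right)
      qed
      then show "\<forall>\<^sub>F u in at u\<^sub>0. dist ((SUP A\<in>\<Psi> u. ?r u A) / norm (u - u\<^sub>0)) 0 < \<epsilon>"
        by (simp add: eventually_at_filter)
    qed
    then show "((\<lambda>u. (SUP A\<in>\<Psi> u. ?r u A) / norm (u - u\<^sub>0)) \<longlongrightarrow> 0) (at u\<^sub>0 within U)"
      unfolding at_within_open[OF assms(2,1)] .
  qed
  then show ?thesis
    unfolding semismooth_wrt_def dom using assms by blast
qed

section \<open>Local norm bounds from differentiability and continuity\<close>

lemma has_derivative_eventually_norm_le:
  fixes g :: "'a::real_normed_vector \<Rightarrow> 'b::real_normed_vector"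
  assumes "(g has_derivative G) (at z)" "e > 0"
  shows "\<forall>\<^sub>F x in nhds z. norm (g x - g z - G (x - z)) \<le> e * norm (x - z)"
  using assms unfolding has_derivative_at_alt eventually_nhds_metric dist_norm by blast

lemma has_derivative_eventually_lipschitz:
  assumes "(g has_derivative blinfun_apply G) (at z)"
  shows "\<forall>\<^sub>F x in nhds z. norm (g x - g z) \<le> (norm G + 1) * norm (x - z)"
  using has_derivative_eventually_norm_le[OF assms zero_less_one]
proof eventually_elim
  case (elim x)
  have "norm (g x - g z) \<le> norm (g x - g z - G (x - z)) + norm (G (x - z))"
    by (metis diff_add_cancel norm_triangle_ineq)
  then show ?case
    using elim norm_blinfun[of G "x - z"] by (simp add: distrib_right)
qed

lemma isCont_tendsto_nhds: "isCont g z \<Longrightarrow> (g \<longlongrightarrow> g z) (nhds z)"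
  unfolding isCont_def by (rule tendsto_at_iff_tendsto_nhds[THEN iffD1])

lemma isCont_eventually_norm_le:
  fixes g :: "'a::t2_space \<Rightarrow> 'b::real_normed_vector"
  assumes "isCont g z"
  shows "\<forall>\<^sub>F x in nhds z. norm (g x) \<le> norm (g z) + 1"
proof -
  have "((\<lambda>x. norm (g x)) \<longlongrightarrow> norm (g z)) (nhds z)"
    using assms by (intro tendsto_norm) (rule isCont_tendsto_nhds)
  from order_tendstoD(2)[OF this, of "norm (g z) + 1"] show ?thesis
    by (auto elim: eventually_mono)
qed

subsection \<open>Comparison of the estimates\<close>

context lipschitz_graph_chart
begin

text \<open>The derivative is taken at the moving point \<open>z\<close>, since subspaces at
  \<open>z\<close> are pulled back through \<open>D z\<close>. Differentiability at
  \<open>z\<^sub>0\<close> costs half of \<open>e\<close>, continuity of \<open>D\<close> the other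
  half.\<close>

lemma \<Phi>_expansion:
  assumes "z\<^sub>0 \<in> W" "e > 0"
  shows "\<forall>\<^sub>F z in nhds z\<^sub>0. norm (\<Phi> z - \<Phi> z\<^sub>0 - D z (z - z\<^sub>0)) \<le> e * norm (z - z\<^sub>0)"
proof -
  have "(D \<longlongrightarrow> D z\<^sub>0) (nhds z\<^sub>0)"
    using isCont_D[OF assms(1)] by (rule isCont_tendsto_nhds)
  then have "\<forall>\<^sub>F z in nhds z\<^sub>0. norm (D z - D z\<^sub>0) < e / 2"
    using half_gt_zero[OF assms(2)] unfolding dist_norm[symmetric] by (rule tendstoD)
  then show ?thesis
    using has_derivative_eventually_norm_le[OF \<Phi>_derivative[OF assms(1)] half_gt_zero[OF assms(2)]]
  proof eventually_elim
    case (elim z)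
    have "norm ((D z - D z\<^sub>0) (z - z\<^sub>0)) \<le> e / 2 * norm (z - z\<^sub>0)"
      using elim(1) by (intro order_trans[OF norm_blinfun] mult_right_mono) auto
    moreover have "\<Phi> z - \<Phi> z\<^sub>0 - D z (z - z\<^sub>0) =
        (\<Phi> z - \<Phi> z\<^sub>0 - D z\<^sub>0 (z - z\<^sub>0)) - (D z - D z\<^sub>0) (z - z\<^sub>0)"
      by (simp add: blinfun.diff_left)
    ultimately show ?case
      using elim(2) norm_triangle_ineq4[of "\<Phi> z - \<Phi> z\<^sub>0 - D z\<^sub>0 (z - z\<^sub>0)" "(D z - D z\<^sub>0) (z - z\<^sub>0)"]
      by (simp add: field_simps)
  qed
qed

text \<open>The inverse chart contributes the factor \<open>K\<close> and the graph map of
  \<open>f\<close> the factor \<open>1 + C\<close>.\<close>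

lemma param_eventually_lipschitz:
  assumes "u\<^sub>0 \<in> U"
  obtains M where "M > 0" "\<forall>\<^sub>F u in nhds u\<^sub>0. norm (param u - param u\<^sub>0) \<le> M * norm (u - u\<^sub>0)"
proof -
  define K where "K = norm (E (u\<^sub>0, f u\<^sub>0)) + 1"
  have "K > 0"
    unfolding K_def using norm_ge_zero[of "E (u\<^sub>0, f u\<^sub>0)"] by linarith
  have "C \<ge> 0"
    using lipschitz by (rule lipschitz_on_nonneg)
  have lim: "((\<lambda>u. (u, f u)) \<longlongrightarrow> (u\<^sub>0, f u\<^sub>0)) (nhds u\<^sub>0)"
    by (rule isCont_tendsto_nhds[OF isCont_graph[OF assms]])
  have "(\<Psi> has_derivative E (u\<^sub>0, f u\<^sub>0)) (at (u\<^sub>0, f u\<^sub>0))"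
    using \<Phi>_param[OF assms] param_in_W[OF assms] by (intro inv_derivative) force
  from eventually_compose_filterlim[OF has_derivative_eventually_lipschitz[OF this] lim]
  have "\<forall>\<^sub>F u in nhds u\<^sub>0. norm (param u - param u\<^sub>0) \<le> K * norm ((u, f u) - (u\<^sub>0, f u\<^sub>0))"
    by (simp add: param_def K_def)
  then have "\<forall>\<^sub>F u in nhds u\<^sub>0. norm (param u - param u\<^sub>0) \<le> K * (1 + C) * norm (u - u\<^sub>0)"
    using eventually_nhds_in_open[OF open_U assms]
  proof eventually_elim
    case (elim u)
    have "norm ((u, f u) - (u\<^sub>0, f u\<^sub>0)) \<le> norm (u - u\<^sub>0) + norm (f u - f u\<^sub>0)"
      by (simp add: norm_Pair_le)
    also have "\<dots> \<le> (1 + C) * norm (u - u\<^sub>0)"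
      using lipschitz_onD[OF lipschitz elim(2) assms] by (simp add: dist_norm distrib_right)
    finally have "K * norm ((u, f u) - (u\<^sub>0, f u\<^sub>0)) \<le> K * ((1 + C) * norm (u - u\<^sub>0))"
      using \<open>K > 0\<close> by (intro mult_left_mono) auto
    with elim(1) show ?case
      by (simp add: mult.assoc)
  qed
  moreover have "K * (1 + C) > 0"
    using \<open>K > 0\<close> \<open>C \<ge> 0\<close> by simp
  ultimately show thesis
    using that by blast
qed

text \<open>Continuity of \<open>param\<close> moves local statements on \<open>gph F\<close> to
  parameters; \<open>eventually_proj\<close> moves them back.\<close>

lemma eventually_param:
  assumes "z\<^sub>0 \<in> gph F" "z\<^sub>0 \<in> W" and P: "\<forall>\<^sub>F z in nhds z\<^sub>0. z \<in> gph F \<longrightarrow> P z"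
  shows "\<forall>\<^sub>F u in nhds (proj z\<^sub>0). P (param u)"
proof -
  have "(param \<longlongrightarrow> z\<^sub>0) (nhds (proj z\<^sub>0))"
    using isCont_tendsto_nhds[OF isCont_param[OF proj_in_U[OF assms(1,2)]]] param_proj[OF assms(1,2)]
    by simp
  from eventually_compose_filterlim[OF P this] eventually_nhds_in_open[OF open_U proj_in_U[OF assms(1,2)]]
  show ?thesis
    by eventually_elim (simp add: param_in_gph)
qed

lemma eventually_proj:
  assumes "z\<^sub>0 \<in> W" "\<forall>\<^sub>F u in nhds (proj z\<^sub>0). P u"
  shows "\<forall>\<^sub>F z in nhds z\<^sub>0. P (proj z)"
  using assms(2)
proof (rule eventually_compose_filterlim)
  show "(proj \<longlongrightarrow> proj z\<^sub>0) (nhds z\<^sub>0)"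
    using isCont_proj[OF assms(1)] by (rule isCont_tendsto_nhds)
qed

lemma B_Jacobian_bounded: "bounded (\<Union>u\<in>S. B_Jacobian U f u)"
proof (rule boundedI)
  fix A assume "A \<in> (\<Union>u\<in>S. B_Jacobian U f u)"
  then obtain u where "A \<in> B_Jacobian U f u"
    by blast
  then show "norm A \<le> real CARD('m) * (real CARD('n) * C)"
    by (intro norm_matrix_le_if_bounded B_Jacobian_lipschitz_bound[OF open_U lipschitz])
qed

text \<open>A vector \<open>l\<close> of the pullback close to \<open>z - z\<^sub>0\<close> is sent
  by \<open>D z\<close> to a point on the graph of \<open>A\<close>, close to the increment of
  \<Phi>. The deviation of that increment from the graph is the semismoothness residual.\<close>

lemma semismooth_if_SCD_ss_star:
  assumes z\<^sub>0: "z\<^sub>0 \<in> gph F" "z\<^sub>0 \<in> W" and SCD: "SCD_ss_star F z\<^sub>0"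
  shows "semismooth_wrt U f (B_Jacobian U f) (proj z\<^sub>0)"
proof -
  define u\<^sub>0 where "u\<^sub>0 = proj z\<^sub>0"
  have u\<^sub>0: "u\<^sub>0 \<in> U" "param u\<^sub>0 = z\<^sub>0"
    by (simp_all add: u\<^sub>0_def proj_in_U[OF z\<^sub>0] param_proj[OF z\<^sub>0])
  have in_U: "\<forall>\<^sub>F u in nhds u\<^sub>0. u \<in> U"
    by (rule eventually_nhds_in_open[OF open_U u\<^sub>0(1)])
  have SC: "SC_derivative F (param u) = pullback (param u) ` B_Jacobian U f u" if "u \<in> U" for u
    using SC_derivative_eq[OF param_in_gph[OF that] param_in_W[OF that]] by (simp add: proj_param[OF that])
  have "\<forall>\<^sub>F z in nhds z\<^sub>0. z \<in> gph F \<longrightarrow> SC_derivative F z \<noteq> {}"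
    using SCD by (simp add: SCD_ss_star_iff)
  from eventually_param[OF z\<^sub>0 this] in_U
  have ne: "\<forall>\<^sub>F u in nhds u\<^sub>0. B_Jacobian U f u \<noteq> {}"
    unfolding u\<^sub>0_def by eventually_elim (simp add: SC)
  have "\<forall>\<^sub>F u in nhds u\<^sub>0. \<forall>A\<in>B_Jacobian U f u. norm (f u - f u\<^sub>0 - A *v (u - u\<^sub>0)) \<le> \<epsilon> * norm (u - u\<^sub>0)"
    if "\<epsilon> > 0" for \<epsilon>
  proof -
    obtain M where "M > 0" and M: "\<forall>\<^sub>F u in nhds u\<^sub>0. norm (param u - param u\<^sub>0) \<le> M * norm (u - u\<^sub>0)"
      using param_eventually_lipschitz[OF u\<^sub>0(1)] .
    define K where "K = norm (D z\<^sub>0) + 1"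
    have "K > 0"
      unfolding K_def using norm_ge_zero[of "D z\<^sub>0"] by linarith
    have "C \<ge> 0"
      using lipschitz by (rule lipschitz_on_nonneg)
    \<comment> \<open>The factors are the later losses: \<open>1 + C\<close> from reading the
      residual off the graph of \<open>A\<close>, \<open>1 + K\<close> from the expansion and from
      \<open>D z\<close>, and \<open>M\<close> from returning to parameters.\<close>
    define \<delta> where "\<delta> = \<epsilon> / ((1 + C) * (1 + K) * M)"
    have "\<delta> > 0"
      using \<open>\<epsilon> > 0\<close> \<open>M > 0\<close> \<open>K > 0\<close> \<open>C \<ge> 0\<close> by (simp add: \<delta>_def)
    have \<delta>: "(1 + C) * (1 + K) * \<delta> * M = \<epsilon>"
      using \<open>M > 0\<close> \<open>K > 0\<close> \<open>C \<ge> 0\<close> by (simp add: \<delta>_def)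
    have "\<forall>\<^sub>F z in nhds z\<^sub>0. z \<in> gph F \<longrightarrow>
        (\<forall>L\<in>SC_derivative F z. \<exists>l\<in>L. norm (z - z\<^sub>0 - l) \<le> \<delta> * norm (z - z\<^sub>0))"
      using SCD \<open>\<delta> > 0\<close> by (simp add: SCD_ss_star_iff)
    then have "\<forall>\<^sub>F z in nhds z\<^sub>0. z \<in> gph F \<longrightarrow>
        (\<forall>L\<in>SC_derivative F z. \<exists>l\<in>L. norm (z - z\<^sub>0 - l) \<le> \<delta> * norm (z - z\<^sub>0)) \<and>
        norm (\<Phi> z - \<Phi> z\<^sub>0 - D z (z - z\<^sub>0)) \<le> \<delta> * norm (z - z\<^sub>0) \<and> norm (D z) \<le> K"
      using \<Phi>_expansion[OF z\<^sub>0(2) \<open>\<delta> > 0\<close>] isCont_eventually_norm_le[OF isCont_D[OF z\<^sub>0(2)]]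
      unfolding K_def by eventually_elim blast
    from eventually_param[OF z\<^sub>0 this] in_U M show ?thesis
      unfolding u\<^sub>0_def[symmetric]
    proof eventually_elim
      case (elim u)
      define z where "z = param u"
      define q where "q = z - z\<^sub>0"
      show ?case
      proof
        fix A assume A: "A \<in> B_Jacobian U f u"
        then have "pullback z A \<in> SC_derivative F z"
          using SC[OF elim(2)] by (simp add: z_def)
        then obtain l where l: "l \<in> pullback z A" "norm (q - l) \<le> \<delta> * norm q"
          using elim(1) by (auto simp: z_def q_def)
        define h where "h = fst (D z l)"
        have Dl: "D z l = (h, A *v h)"
          using l(1) by (simp add: pullback_def h_def prod_eq_iff)
        have \<Phi>: "\<Phi> z - \<Phi> z\<^sub>0 = (u - u\<^sub>0, f u - f u\<^sub>0)"
          using \<Phi>_param[OF elim(2)] \<Phi>_param[OF u\<^sub>0(1)] u\<^sub>0(2) by (simp add: z_def)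
        define s where "s = \<Phi> z - \<Phi> z\<^sub>0 - D z l"
        have "s = (\<Phi> z - \<Phi> z\<^sub>0 - D z q) + D z (q - l)"
          by (simp add: s_def blinfun.diff_right)
        also have "norm \<dots> \<le> \<delta> * norm q + K * (\<delta> * norm q)"
          using elim(1) l(2) \<open>K > 0\<close>
          by (intro norm_triangle_le add_mono order_trans[OF norm_blinfun] mult_mono)
            (auto simp: z_def q_def)
        finally have s: "norm s \<le> (1 + K) * \<delta> * norm q"
          by (simp add: algebra_simps)
        \<comment> \<open>The point \<open>D z l = (h, A *v h)\<close> lies on the graph of
          \<open>A\<close>, so subtracting it leaves the residual unchanged.\<close>
        have "f u - f u\<^sub>0 - A *v (u - u\<^sub>0) = snd s - A *v fst s"
          by (simp add: s_def \<Phi> Dl matrix_vector_mult_diff_distrib)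
        also have "norm \<dots> \<le> norm (snd s) + norm (A *v fst s)"
          by (rule norm_triangle_ineq4)
        also have "\<dots> \<le> norm s + C * norm s"
          using B_Jacobian_lipschitz_bound[OF open_U lipschitz A, of "fst s"] norm_fst_le[of "fst s" "snd s"]
            norm_snd_le[of "snd s" "fst s"] mult_left_mono[OF norm_fst_le[of "fst s" "snd s"] \<open>C \<ge> 0\<close>]
          by simp
        also have "\<dots> = (1 + C) * norm s"
          by (simp add: distrib_right)
        also have "\<dots> \<le> (1 + C) * ((1 + K) * \<delta> * (M * norm (u - u\<^sub>0)))"
          using elim(3) \<open>C \<ge> 0\<close> \<open>K > 0\<close> \<open>\<delta> > 0\<close>
          by (intro mult_left_mono order_trans[OF s]) (auto simp: q_def z_def u\<^sub>0(2))
        also have "\<dots> = \<epsilon> * norm (u - u\<^sub>0)"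
          by (simp flip: \<delta>)
        finally show "norm (f u - f u\<^sub>0 - A *v (u - u\<^sub>0)) \<le> \<epsilon> * norm (u - u\<^sub>0)" .
      qed
    qed
  qed
  then show ?thesis
    unfolding semismooth_wrt_iff[OF open_U proj_in_U[OF z\<^sub>0] open_UNIV UNIV_I B_Jacobian_bounded]
    using ne by (simp add: u\<^sub>0_def)
qed

text \<open>The point of the graph of \<open>A\<close> above the parameter increment differs from
  the increment of \<Phi> by the vertical residual alone; pulled back, it is the required nearby
  vector of \<open>L\<close>.\<close>

lemma SCD_ss_star_if_semismooth:
  assumes z\<^sub>0: "z\<^sub>0 \<in> gph F" "z\<^sub>0 \<in> W"
    and semismooth: "semismooth_wrt U f (B_Jacobian U f) (proj z\<^sub>0)"
  shows "SCD_ss_star F z\<^sub>0"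
proof -
  note ss = semismooth[unfolded semismooth_wrt_iff[OF open_U proj_in_U[OF z\<^sub>0] open_UNIV UNIV_I B_Jacobian_bounded]]
  have in_W: "\<forall>\<^sub>F z in nhds z\<^sub>0. z \<in> W"
    by (rule eventually_nhds_in_open[OF open_W z\<^sub>0(2)])
  have "\<forall>\<^sub>F z in nhds z\<^sub>0. B_Jacobian U f (proj z) \<noteq> {}"
    using ss by (intro eventually_proj z\<^sub>0(2)) blast
  then have ne: "\<forall>\<^sub>F z in nhds z\<^sub>0. z \<in> gph F \<longrightarrow> SC_derivative F z \<noteq> {}"
    using in_W by eventually_elim (simp add: SC_derivative_eq)
  have "\<forall>\<^sub>F z in nhds z\<^sub>0. z \<in> gph F \<longrightarrow>
      (\<forall>L\<in>SC_derivative F z. \<exists>l\<in>L. norm (z - z\<^sub>0 - l) \<le> \<epsilon> * norm (z - z\<^sub>0))" if "\<epsilon> > 0" for \<epsilon>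
  proof -
    define K where "K = norm (D z\<^sub>0) + 1"
    have "K > 0"
      unfolding K_def using norm_ge_zero[of "D z\<^sub>0"] by linarith
    define K' where "K' = norm (E (\<Phi> z\<^sub>0)) + 1"
    have "K' > 0"
      unfolding K'_def using norm_ge_zero[of "E (\<Phi> z\<^sub>0)"] by linarith
    \<comment> \<open>\<open>K'\<close> bounds the inverse derivative near \<open>z\<^sub>0\<close>;
      in \<open>1 + K\<close>, the 1 accounts for the expansion error and \<open>K\<close> for
      bounding \<open>norm h\<close> by the distance in the graph.\<close>
    define \<delta> where "\<delta> = \<epsilon> / (K' * (1 + K))"
    have "\<delta> > 0"
      using \<open>\<epsilon> > 0\<close> \<open>K > 0\<close> \<open>K' > 0\<close> by (simp add: \<delta>_def)
    have \<delta>: "K' * ((1 + K) * \<delta>) = \<epsilon>"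
      using \<open>K > 0\<close> \<open>K' > 0\<close> by (simp add: \<delta>_def)
    have "\<forall>\<^sub>F z in nhds z\<^sub>0. \<forall>A\<in>B_Jacobian U f (proj z).
        norm (f (proj z) - f (proj z\<^sub>0) - A *v (proj z - proj z\<^sub>0)) \<le> \<delta> * norm (proj z - proj z\<^sub>0)"
      using ss \<open>\<delta> > 0\<close> by (intro eventually_proj z\<^sub>0(2)) blast
    then show ?thesis
      using in_W \<Phi>_expansion[OF z\<^sub>0(2) \<open>\<delta> > 0\<close>]
        has_derivative_eventually_lipschitz[OF \<Phi>_derivative[OF z\<^sub>0(2)], folded K_def]
        isCont_eventually_norm_le[OF isCont_E_\<Phi>[OF z\<^sub>0(2)], folded K'_def]
    proof eventually_elim
      case (elim z)
      show ?case
      proof (intro impI ballI)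
        fix L assume z: "z \<in> gph F" and "L \<in> SC_derivative F z"
        then obtain A where A: "A \<in> B_Jacobian U f (proj z)" and L: "L = pullback z A"
          using SC_derivative_subset[OF z elim(2)] by blast
        define q where "q = z - z\<^sub>0"
        define h where "h = proj z - proj z\<^sub>0"
        define r where "r = f (proj z) - f (proj z\<^sub>0) - A *v h"
        define l where "l = E (\<Phi> z) (h, A *v h)"
        have \<Phi>: "\<Phi> z - \<Phi> z\<^sub>0 = (h, A *v h + r)"
          by (simp add: \<Phi>_gph[OF z elim(2)] \<Phi>_gph[OF z\<^sub>0] h_def r_def)
        have "norm h \<le> norm (\<Phi> z - \<Phi> z\<^sub>0)"
          unfolding \<Phi> by (rule norm_fst_le)
        then have h: "norm h \<le> K * norm q"
          using elim(4) by (simp add: q_def)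
        have "norm r \<le> \<delta> * norm h"
          using elim(1) A by (simp add: r_def h_def)
        also have "\<dots> \<le> \<delta> * (K * norm q)"
          using h \<open>\<delta> > 0\<close> by simp
        finally have r: "norm (0 :: real^'n, r) \<le> \<delta> * (K * norm q)"
          by (simp add: norm_Pair)
        \<comment> \<open>This combines the vertical residual with the expansion error; it equals
          \<open>D z (q - l)\<close>, so applying \<open>E (\<Phi> z)\<close> recovers
          \<open>q - l\<close>.\<close>
        define s where "s = (0, r) - (\<Phi> z - \<Phi> z\<^sub>0 - D z q)"
        have "s = D z q - (h, A *v h)"
          unfolding s_def \<Phi> by (simp add: prod_eq_iff)
        then have "q - l = E (\<Phi> z) s"
          by (simp add: blinfun.diff_right E_D[OF elim(2)] l_def)
        then have "norm (q - l) \<le> norm (E (\<Phi> z)) * norm s"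
          using norm_blinfun by simp
        also have "\<dots> \<le> K' * norm s"
          using elim(5) by (rule mult_right_mono) simp
        also have "norm s \<le> norm (0 :: real^'n, r) + norm (\<Phi> z - \<Phi> z\<^sub>0 - D z q)"
          unfolding s_def by (rule norm_triangle_ineq4)
        also have "\<dots> \<le> \<delta> * (K * norm q) + \<delta> * norm q"
          using r elim(3) by (simp add: q_def)
        also have "K' * (\<delta> * (K * norm q) + \<delta> * norm q) = \<epsilon> * norm q"
          by (simp add: algebra_simps flip: \<delta>)
        finally have "norm (q - l) \<le> \<epsilon> * norm q"
          using \<open>K' > 0\<close> by simp
        moreover have "l \<in> L"
          by (auto simp: L pullback_eq_image[OF elim(2)] l_def)
        ultimately show "\<exists>l\<in>L. norm (z - z\<^sub>0 - l) \<le> \<epsilon> * norm (z - z\<^sub>0)"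
          by (auto simp: q_def)
      qed
    qed
  qed
  with ne z\<^sub>0(1) show ?thesis
    by (simp add: SCD_ss_star_iff)
qed

end

theorem proposition4p2:
  fixes F :: "real^'n \<Rightarrow> (real^'m) set"
    and xbar :: "real^'n" and ybar :: "real^'m"
    and W :: "((real^'n) \<times> (real^'m)) set"
    and \<Phi> :: "(real^'n) \<times> (real^'m) \<Rightarrow> (real^'n) \<times> (real^'m)"
    and U :: "(real^'n) set" and f :: "real^'n \<Rightarrow> real^'m"
    and ubar :: "real^'n"
  assumes "graphically_lipschitzian_via F (xbar, ybar) W \<Phi> U f"
    and "\<Phi> (xbar, ybar) = (ubar, f ubar)"
  shows "SCD_ss_star F (xbar, ybar) \<longleftrightarrow> semismooth_wrt U f (B_Jacobian U f) ubar"
proof -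
  have chart: "open W" "open (\<Phi> ` W)" "inj_on \<Phi> W" "open U" "\<exists>C. C-lipschitz_on U f"
      "continuously_differentiable_on \<Phi> W"
      "continuously_differentiable_on (the_inv_into W \<Phi>) (\<Phi> ` W)"
      "\<Phi> ` (gph F \<inter> W) = fun_graph U f"
    and z: "(xbar, ybar) \<in> gph F" "(xbar, ybar) \<in> W"
    using assms(1) unfolding graphically_lipschitzian_via_def fun_graph_def by - ((elim conjE; assumption)+)
  obtain C where C: "C-lipschitz_on U f"
    using chart(5) by blast
  obtain D where D: "\<forall>z\<in>W. (\<Phi> has_derivative blinfun_apply (D z)) (at z)" "continuous_on W D"
    using chart(6) unfolding continuously_differentiable_on_def by blast
  obtain E where E: "\<forall>p\<in>\<Phi> ` W. (the_inv_into W \<Phi> has_derivative blinfun_apply (E p)) (at p)"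
      "continuous_on (\<Phi> ` W) E"
    using chart(7) unfolding continuously_differentiable_on_def by blast
  interpret lipschitz_graph_chart F W \<Phi> U f C D E
    by standard (simp_all only: chart C D E bspec[OF D(1)] bspec[OF E(1)])
  have "proj (xbar, ybar) = ubar"
    by (simp add: proj_def assms(2))
  then show ?thesis
    using semismooth_if_SCD_ss_star[OF z] SCD_ss_star_if_semismooth[OF z] by metis
qed

end
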